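(* Let $n\ge2$ and let $$D=\prod_{l=0}^{2^{n-2}-2}\langle d_{2l+1}\rangle=\langle d_1\rangle\times\langle d_3\rangle\times\dots\times\langle d_{2^{n-1}-3}\rangle$$ (the subgroup generated by these $d_{2l+1}$ is their internal direct product). Then: 1. $K(\alpha)=\langle\alpha\rangle\times D$. 2. $K(\alpha)\cap\mathbf{R}=\langle-1\rangle\times D$.
   Context: Let $\alpha=e^{2\pi i/2^n}$ and $\mathbf{Q}_{2^n}=\mathbf{Q}(\alpha)$, with ring of integers $\mathbf{Z}[\alpha]$ and unit group $\mathrm{Un}(\mathbf{Z}[\alpha])$. For an integer $j$ put $d_j=1+\alpha^j+\alpha^{-j}$. Let $P=\langle 1-\alpha^k\mid k\in\{1,2,\dots,2^n-1\}\rangle$ be the subgroup of the multiplicative group $\mathbf{Q}_{2^n}^*$ generated by these elements. The group of circular units of $\mathbf{Q}_{2^n}$ is $K(\alpha)=P\cap\mathrm{Un}(\mathbf{Z}[\alpha])$. For $n=2$ the group $D$ is trivial (empty product). *)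

theory Defs
  imports Complex_Main "HOL-Algebra.Algebra" "HOL-Algebra.Algebraic_Closure_Type"
begin

abbreviation complex_field :: "complex ring"
  where "complex_field \<equiv> ring_of_type_algebra"

definition root2n :: "nat \<Rightarrow> complex"
  where "root2n n = exp (2 * complex_of_real pi * \<i> / 2 ^ n)"

definition cyclotomic_field :: "nat \<Rightarrow> complex ring"
  where "cyclotomic_field n =
    complex_field\<lparr>carrier := generate_field complex_field {root2n n}\<rparr>"

definition cyclotomic_integers :: "nat \<Rightarrow> complex ring"
  where "cyclotomic_integers n =
    complex_field\<lparr>carrier := generate_ring complex_field {root2n n}\<rparr>"

abbreviation cyclotomic_group :: "nat \<Rightarrow> complex monoid"
  where "cyclotomic_group n \<equiv> Multiplicative_Group.mult_of (cyclotomic_field n)"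

definition circular_numbers :: "nat \<Rightarrow> complex set"
  where "circular_numbers n =
    generate (cyclotomic_group n) {1 - root2n n ^ k |k. k \<in> {1..2 ^ n - 1}}"

definition circular_units :: "nat \<Rightarrow> complex set"
  where "circular_units n = circular_numbers n \<inter> Units (cyclotomic_integers n)"

definition circular_d :: "nat \<Rightarrow> int \<Rightarrow> complex"
  where "circular_d n j = 1 + root2n n powi j + root2n n powi (- j)"

text \<open>Natural-number subtraction makes this index set empty for \<open>n = 2\<close>, as intended.\<close>

definition d_indices :: "nat \<Rightarrow> nat set"
  where "d_indices n = {l. l < 2 ^ (n - 2) - 1}"

definition d_factor :: "nat \<Rightarrow> nat \<Rightarrow> complex set"
  where "d_factor n l = generate (cyclotomic_group n) {circular_d n (2 * int l + 1)}"

definition d_group :: "nat \<Rightarrow> complex set"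
  where "d_group n =
    generate (cyclotomic_group n) {circular_d n (2 * int l + 1) |l. l \<in> d_indices n}"

text \<open>Internal direct products in an abelian group \<open>G\<close>: the multiplication map from the external
  direct product of the given subgroups is an isomorphism onto the stated subset. The index set
  of a family is meant to be finite, since \<^const>\<open>finprod\<close> is only meaningful there.\<close>

definition internal_direct_product ::
    "('a, 'b) monoid_scheme \<Rightarrow> 'i set \<Rightarrow> ('i \<Rightarrow> 'a set) \<Rightarrow> 'a set \<Rightarrow> bool"
  where "internal_direct_product G I H S \<longleftrightarrow>
    (\<forall>i\<in>I. subgroup (H i) G) \<and> subgroup S G \<and>
    (\<lambda>x. finprod G x I) \<in> iso (product_group I (\<lambda>i. G\<lparr>carrier := H i\<rparr>)) (G\<lparr>carrier := S\<rparr>)"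

definition internal_direct_product2 ::
    "('a, 'b) monoid_scheme \<Rightarrow> 'a set \<Rightarrow> 'a set \<Rightarrow> 'a set \<Rightarrow> bool"
  where "internal_direct_product2 G A B S \<longleftrightarrow>
    subgroup A G \<and> subgroup B G \<and> subgroup S G \<and>
    (\<lambda>(x, y). x \<otimes>\<^bsub>G\<^esub> y) \<in> iso (G\<lparr>carrier := A\<rparr> \<times>\<times> G\<lparr>carrier := B\<rparr>) (G\<lparr>carrier := S\<rparr>)"

end

theory Submission
  imports Defs
    "HOL-Computational_Algebra.Polynomial_Factorial"
    "HOL-Computational_Algebra.Field_as_Ring"
    "HOL-Computational_Algebra.Fundamental_Theorem_Algebra"
begin

text \<open>
  Write \<open>\<alpha>\<close> for the root of unity of order \<open>2^n\<close> and \<open>N = 2^(n - 2)\<close>.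

  Generation. From \<open>d_j = \<alpha>^(-j) (1 - \<alpha>^(3j)) / (1 - \<alpha>^j)\<close> one can pass from
  \<open>1 - \<alpha>^j\<close> to \<open>1 - \<alpha>^(3j)\<close> inside the group generated by \<open>\<alpha>\<close> and the \<open>d_j\<close>. Since every odd
  residue modulo \<open>2^n\<close> is \<open>\<plusminus> 3^i\<close>, and since \<open>1 - x^2 = (1 - x) (1 + x)\<close> takes care of even exponents,
  every circular number is \<open>w (1 - \<alpha>)^e\<close> with \<open>w\<close> in that group
  (\<open>one_minus_power_factorisation\<close>). The \<open>d_j\<close> with \<open>j\<close> odd are units, a nonzero power of
  \<open>1 - \<alpha>\<close> is not, so \<open>e = 0\<close> for a circular unit. The product of all \<open>N\<close> elements
  \<open>d_1, d_3, \<dots>, d_(2N - 1)\<close> is \<open>\<plusminus> 1\<close> (\<open>circular_d_prod\<close>), which makes the last one superfluous.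

  Independence. For general cyclotomic fields one would invoke the nonvanishing of
  \<open>L(1, \<chi>)\<close>; for two-power order a descent through the tower of fields suffices. Consider the real
  sequence \<open>s_n(i) = ln |d_(3^i)|\<close> at level \<open>n\<close>, and let rational polynomials act on sequences
  with the variable \<open>x\<close> acting as the shift. A multiplicative relation between the \<open>d_j\<close> has
  conjugates under all Galois automorphisms \<open>\<alpha> \<mapsto> \<alpha>^(3^k)\<close>; together these say that a polynomial
  \<open>f\<close> of degree less than \<open>N\<close>, whose coefficients are the exponents, annihilates \<open>s_n\<close>. Every such
  \<open>f\<close> is divisible by \<open>1 + x + \<dots> + x^(N - 1)\<close> (\<open>log_d_annihilator\<close>), so all exponents agree; the
  exponent of \<open>d_(2N - 1)\<close> being \<open>0\<close>, all vanish (\<open>circular_d_independent\<close>).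

  The divisibility is proved by induction on \<open>n\<close>. The relative norm of \<open>d_j\<close> is, up to sign, the
  \<open>d_j\<close> one level below, that is \<open>(x^N + 1) s_(n + 1) = s_n\<close>. Hence an \<open>f\<close> that annihilates
  \<open>s_(n + 1)\<close> also annihilates \<open>s_n\<close> and is divisible by \<open>1 + x + \<dots> + x^(N - 1)\<close>. If it were not
  divisible by the irreducible polynomial \<open>x^N + 1\<close>, a Bezout relation would express \<open>s_(n + 1)\<close>
  through \<open>s_n\<close>, so \<open>s_(n + 1)\<close> would have period \<open>N\<close>. That would mean \<open>|1 + c| = |1 - c|\<close> for the
  nonzero real number \<open>c = \<alpha> + 1/\<alpha>\<close>.

  Both the irreducibility of \<open>x^(2^r) + 1\<close> and the fact that \<open>1 - \<alpha>\<close> is no unit come from one parity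
  statement: an integer polynomial that vanishes at \<open>\<alpha>\<close> is even at \<open>1\<close>
  (\<open>even_at_1_if_root\<close>).

  Directness. \<open>D\<close> consists of real numbers, the only real powers of \<open>\<alpha>\<close> are \<open>\<plusminus> 1\<close>, and by
  independence \<open>D\<close> contains no \<open>-1\<close>.
\<close>

section \<open>The irreducibility of \<open>x^(2^r) + 1\<close>\<close>

lemma map_poly_ring_hom_add:
  assumes "h 0 = 0" "\<And>x y. h (x + y) = h x + h y"
  shows "map_poly h (p + q) = map_poly h p + map_poly h q"
  by (rule poly_eqI) (simp add: coeff_map_poly assms)

lemma map_poly_ring_hom_mult:
  fixes h :: "'a::comm_ring_1 \<Rightarrow> 'b::comm_ring_1"
  assumes "h 0 = 0" "\<And>x y. h (x + y) = h x + h y" "\<And>x y. h (x * y) = h x * h y"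
  shows "map_poly h (p * q) = map_poly h p * map_poly h q"
proof (induction p)
  case (pCons c p)
  show ?case
    by (simp add: map_poly_ring_hom_add map_poly_smult map_poly_pCons assms pCons.IH)
qed simp

lemmas of_int_poly_add = map_poly_ring_hom_add[where h = of_int, OF of_int_0 of_int_add]
lemmas of_int_poly_mult = map_poly_ring_hom_mult[where h = of_int, OF of_int_0 of_int_add of_int_mult]
lemmas of_rat_poly_add = map_poly_ring_hom_add[where h = of_rat, OF of_rat_0 of_rat_add]
lemmas of_rat_poly_mult = map_poly_ring_hom_mult[where h = of_rat, OF of_rat_0 of_rat_add of_rat_mult]

lemma even_odd_decomposition:
  fixes f :: "int poly"
  shows "\<exists>g h. (\<forall>z::complex. poly (map_poly of_int f) z =
            poly (map_poly of_int g) (z^2) + z * poly (map_poly of_int h) (z^2))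
         \<and> poly f 1 = poly g 1 + poly h 1"
proof (induction f)
  case 0
  show ?case by (intro exI[of _ 0]) simp
next
  case (pCons c f)
  then obtain g h where *: "\<And>z::complex. poly (map_poly of_int f) z =
            poly (map_poly of_int g) (z^2) + z * poly (map_poly of_int h) (z^2)"
         "poly f 1 = poly g 1 + poly h 1"
    by blast
  show ?case
    by (intro exI[of _ "pCons c h"] exI[of _ g])
       (simp add: map_poly_pCons * algebra_simps power2_eq_square)
qed

text \<open>Taking norms one quadratic step at a time: if \<open>f = g(x^2) + x h(x^2)\<close> vanishes at \<open>z\<close>, then
  \<open>f(x) f(-x) = g(x^2)^2 - x^2 h(x^2)^2\<close> is a polynomial in \<open>x^2\<close> which vanishes at \<open>z^2\<close>, and
  its value at \<open>1\<close> has the parity of \<open>f(1)\<close>. After \<open>r\<close> steps the root is \<open>-1\<close>, and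
  \<open>f(1)\<close> is congruent to \<open>f(-1)\<close> modulo \<open>2\<close>. This replaces the prime of the ring of integers
  above \<open>2\<close>.\<close>

lemma even_at_1_if_root:
  fixes f :: "int poly" and z :: complex
  assumes "z ^ (2 ^ r) = -1" "poly (map_poly of_int f) z = 0"
  shows "even (poly f 1)"
  using assms
proof (induction r arbitrary: z f)
  case 0
  then have z: "z = -1" by simp
  have "poly (map_poly of_int f) (of_int (-1) :: complex) = of_int (poly f (-1))" for f
    by (induction f) (simp_all add: map_poly_pCons)
  with 0 z have "poly f (-1) = 0" by (metis of_int_eq_0_iff of_int_minus of_int_1)
  moreover have "even (poly f 1 - poly f (-1))" 
    by (induction f) auto
  ultimately show ?case by simp
next
  case (Suc r)
  obtain g h where *: "\<And>z::complex. poly (map_poly of_int f) z =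
            poly (map_poly of_int g) (z^2) + z * poly (map_poly of_int h) (z^2)"
         "poly f 1 = poly g 1 + poly h 1"
    using even_odd_decomposition by blast
  let ?g = "poly (map_poly of_int g) (z^2)" and ?h = "poly (map_poly of_int h) (z^2)"
  define F where "F = g * g + [:0, -1:] * (h * h)"
  have "poly (map_poly of_int F) (z^2) = ?g * ?g - z^2 * (?h * ?h)"
    by (simp add: F_def of_int_poly_add of_int_poly_mult map_poly_pCons del: mult_pCons_left)
  also have "\<dots> = (?g + z * ?h) * (?g - z * ?h)"
    by (simp add: algebra_simps power2_eq_square)
  also have "\<dots> = 0" using *(1)[of z] Suc.prems by simp
  finally have "poly (map_poly of_int F) (z^2) = 0" .
  moreover have "(z^2) ^ (2 ^ r) = -1"
    using Suc.prems(1) by (simp add: power_mult)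
  ultimately have "even (poly F 1)" by (rule Suc.IH[rotated])
  then show ?case by (simp add: F_def *(2))
qed

lemma clear_denominators:
  "\<exists>k A. k \<noteq> 0 \<and> smult (of_int k) p = (map_poly of_int A :: rat poly)"
proof (induction p)
  case 0
  show ?case by (intro exI[of _ 1] exI[of _ 0]) simp
next
  case (pCons c p)
  then obtain k A where kA: "k \<noteq> 0" "smult (of_int k) p = map_poly of_int A" by blast
  obtain u v where uv: "c = of_int u / of_int v" "v > 0"
    by (metis quotient_of_div quotient_of_denom_pos surj_pair)
  have "smult (of_int (k * v)) (pCons c p) = map_poly of_int (pCons (k * u) (smult v A))"
    using uv kA by (simp add: map_poly_pCons map_poly_smult flip: kA(2))
      (simp add: mult.commute)
  then show ?case using kA(1) uv(2) by (intro exI[of _ "k * v"] exI) auto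
qed

text \<open>By Gauss's lemma a nontrivial factorisation can be taken over the integers. Each factor has a
  complex root, which is a root of \<open>x^(2^r) + 1\<close>, so both factors are even at \<open>1\<close>; but the
  value of \<open>x^(2^r) + 1\<close> there is \<open>2\<close>.\<close>

lemma power2_cyclotomic_irreducible:
  "Factorial_Ring.irreducible (Polynomial.monom 1 (2 ^ r) + 1 :: rat poly)"
    (is "Factorial_Ring.irreducible ?Phi")
proof (rule Factorial_Ring.irreducibleI)
  have dPhi: "Polynomial.degree ?Phi = 2 ^ r"
    by (subst degree_add_eq_left) (simp_all add: degree_monom_eq)
  show "?Phi \<noteq> 0" using dPhi by (metis Polynomial.degree_0 power_not_zero zero_neq_numeral)
  then show "\<not> ?Phi dvd 1" using dPhi by (metis is_unit_iff_degree power_not_zero zero_neq_numeral)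
  fix a b assume ab: "?Phi = a * b"
  show "a dvd 1 \<or> b dvd 1"
  proof (rule ccontr)
    assume "\<not> ?thesis"
    moreover have "a \<noteq> 0" "b \<noteq> 0" using ab \<open>?Phi \<noteq> 0\<close> by auto
    ultimately have deg: "Polynomial.degree a > 0" "Polynomial.degree b > 0"
      by (auto simp: is_unit_iff_degree)
    obtain k A where A: "k \<noteq> 0" "smult (of_int k) a = (map_poly of_int A :: rat poly)"
      using clear_denominators by blast
    obtain l B where B: "l \<noteq> 0" "smult (of_int l) b = (map_poly of_int B :: rat poly)"
      using clear_denominators by blast
    define P where "P = (Polynomial.monom 1 (2 ^ r) + 1 :: int poly)"
    have "map_poly of_int (A * B) = (map_poly of_int (smult (k * l) P) :: rat poly)"
      by (simp add: of_int_poly_mult map_poly_smult P_def of_int_poly_add map_poly_monom flip: A B)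
         (simp add: ab mult.commute)
    then have AB: "A * B = smult (k * l) P"
      by (metis (no_types, lifting) coeff_map_poly of_int_0 of_int_eq_iff poly_eqI)
    have dP: "Polynomial.degree P = 2 ^ r"
      unfolding P_def by (subst degree_add_eq_left) (simp_all add: degree_monom_eq)
    have "content P dvd Polynomial.coeff P (2 ^ r)" by (rule content_dvd_coeff)
    also have "Polynomial.coeff P (2 ^ r) = 1" by (simp add: P_def)
    finally have cP: "content P = 1" by (simp only: is_unit_content_iff)
    have nz: "k * l \<noteq> 0" using A B by simp
    let ?A = "primitive_part A" and ?B = "primitive_part B"
    have "?A * ?B = primitive_part (smult (k * l) P)"
      by (simp add: primitive_part_mult flip: AB)
    also have "\<dots> = smult (sgn (k * l)) P"
      using cP by (simp add: primitive_part_smult primitive_part_prim)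
    finally have pp: "?A * ?B = smult (sgn (k * l)) P" .
    have dA: "Polynomial.degree ?A > 0" "Polynomial.degree ?B > 0"
    proof -
      have "Polynomial.degree (map_poly of_int A :: rat poly) = Polynomial.degree a"
        using A by (simp flip: A(2))
      then show "Polynomial.degree ?A > 0" using deg by (simp add: degree_map_poly)
      have "Polynomial.degree (map_poly of_int B :: rat poly) = Polynomial.degree b"
        using B by (simp flip: B(2))
      then show "Polynomial.degree ?B > 0" using deg by (simp add: degree_map_poly)
    qed
    have ev: "even (poly C 1)" if C: "Polynomial.degree C > 0" "C dvd smult (sgn (k * l)) P" for C
    proof -
      have "Polynomial.degree (map_poly of_int C :: complex poly) > 0"
        using C(1) by (simp add: degree_map_poly)
      then obtain z :: complex where z: "poly (map_poly of_int C) z = 0"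
        using fundamental_theorem_of_algebra constant_degree by (metis less_numeral_extra(3))
      from C(2) obtain D where D: "smult (sgn (k * l)) P = C * D" by (elim dvdE)
      have "poly (map_poly of_int (smult (sgn (k * l)) P)) z = 0"
        unfolding D of_int_poly_mult using z by simp
      then have "z ^ (2 ^ r) = -1"
        using nz by (simp add: map_poly_smult P_def of_int_poly_add map_poly_monom poly_monom
            eq_neg_iff_add_eq_0 sgn_eq_0_iff)
      then show ?thesis using z by (rule even_at_1_if_root)
    qed
    have "even (poly ?A 1)" by (rule ev[OF dA(1)]) (simp flip: pp)
    moreover have "even (poly ?B 1)" by (rule ev[OF dA(2)]) (simp flip: pp)
    ultimately have "2 * 2 dvd poly (?A * ?B) 1" unfolding poly_mult by (rule mult_dvd_mono)
    moreover have "poly (?A * ?B) 1 = sgn (k * l) * 2"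
      unfolding pp by (simp add: P_def poly_monom)
    ultimately show False using nz by (auto simp: sgn_if split: if_splits)
  qed
qed

lemma power2_cyclotomic_bezout:
  fixes f :: "rat poly"
  assumes "\<not> (Polynomial.monom 1 (2 ^ r) + 1) dvd f"
  shows "\<exists>u v. u * f + v * (Polynomial.monom 1 (2 ^ r) + 1) = 1"
proof -
  have "coprime f (Polynomial.monom 1 (2 ^ r) + 1)"
    using assms power2_cyclotomic_irreducible[of r]
    by (metis coprime_commute field_poly_irreducible_imp_prime prime_elem_imp_coprime)
  then show ?thesis
    by (metis bezout_coefficients_fst_snd coprime_imp_gcd_eq_1)
qed

section \<open>Rational polynomials as shift operators on real sequences\<close>

definition shift_act :: "rat poly \<Rightarrow> (nat \<Rightarrow> real) \<Rightarrow> nat \<Rightarrow> real" where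
  "shift_act p s k = (\<Sum>i\<le>Polynomial.degree p. of_rat (Polynomial.coeff p i) * s (k + i))"

lemma shift_act_altdef:
  assumes "Polynomial.degree p \<le> m"
  shows "shift_act p s k = (\<Sum>i\<le>m. of_rat (Polynomial.coeff p i) * s (k + i))"
  unfolding shift_act_def using assms
  by (intro sum.mono_neutral_left) (auto simp: Polynomial.coeff_eq_0)

lemma shift_act_add: "shift_act (p + q) s k = shift_act p s k + shift_act q s k"
proof -
  define m where "m = max (Polynomial.degree p) (Polynomial.degree q)"
  have "Polynomial.degree (p + q) \<le> m" "Polynomial.degree p \<le> m" "Polynomial.degree q \<le> m"
    unfolding m_def by (auto intro: degree_add_le)
  from this[THEN shift_act_altdef[where s = s and k = k]] show ?thesis
    by (simp add: of_rat_add algebra_simps sum.distrib)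
qed

lemma shift_act_smult: "shift_act (Polynomial.smult c p) s k = of_rat c * shift_act p s k"
  by (subst shift_act_altdef[of _ "Polynomial.degree p"])
     (simp_all add: shift_act_def of_rat_mult sum_distrib_left mult.assoc)

lemma shift_act_pCons: "shift_act (pCons c p) s k = of_rat c * s k + shift_act p s (Suc k)"
  by (subst shift_act_altdef[of _ "Suc (Polynomial.degree p)"])
     (simp_all add: degree_pCons_le sum.atMost_Suc_shift shift_act_def del: sum.atMost_Suc)

lemma shift_act_0 [simp]: "shift_act 0 s k = 0"
  by (simp add: shift_act_def)

lemma shift_act_mult: "shift_act (p * q) s k = shift_act p (shift_act q s) k"
proof (induction p arbitrary: k)
  case (pCons c p)
  then show ?case by (simp add: shift_act_add shift_act_smult shift_act_pCons)
qed simp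

lemma shift_act_zero_seq: "(\<And>k. s k = 0) \<Longrightarrow> shift_act p s k = 0"
  by (simp add: shift_act_def)

lemma shift_act_monom: "shift_act (Polynomial.monom c m) s k = of_rat c * s (k + m)"
  by (induction m arbitrary: k)
     (simp_all add: Polynomial.monom_0 monom_Suc shift_act_pCons)

lemma shift_act_1 [simp]: "shift_act 1 s k = s k"
  using shift_act_monom[of 1 0 s k] by simp

lemma shift_act_sum: "shift_act (\<Sum>i\<in>I. f i) s k = (\<Sum>i\<in>I. shift_act (f i) s k)"
  by (induction I rule: infinite_finite_induct) (simp_all add: shift_act_add)

section \<open>Roots of unity of two-power order and the numbers \<open>d_j\<close>\<close>

lemma root2n_nonzero [simp]: "root2n n \<noteq> 0"
  by (simp add: root2n_def)

lemma root2n_Suc_power2: "root2n (Suc n) ^ 2 = root2n n"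
proof -
  have "root2n (Suc n) ^ 2 = exp (of_nat 2 * (2 * complex_of_real pi * \<i> / 2 ^ Suc n))"
    unfolding root2n_def by (simp only: exp_of_nat_mult)
  also have "\<dots> = root2n n" unfolding root2n_def by (rule arg_cong[of _ _ exp]) simp
  finally show ?thesis .
qed

lemma root2n_power_half: "root2n (Suc n) ^ (2 ^ n) = -1"
proof -
  have "root2n (Suc n) ^ (2 ^ n) = exp (of_nat (2 ^ n) * (2 * complex_of_real pi * \<i> / 2 ^ Suc n))"
    unfolding root2n_def by (simp only: exp_of_nat_mult)
  also have "\<dots> = exp (complex_of_real pi * \<i>)" by simp
  finally show ?thesis by simp
qed

lemma norm_root2n [simp]: "norm (root2n n) = 1"
  by (simp add: root2n_def norm_exp_eq_Re)

lemma root2n_power_full: "root2n n ^ (2 ^ n) = 1"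
  using root2n_power_half[of "n - 1"] 
  by (cases n) (simp_all add: power_mult mult.commute[of 2], simp add: root2n_def)

lemma root2n_powi_cong:
  assumes "2 ^ n dvd j - k"
  shows "root2n n powi j = root2n n powi k"
proof -
  obtain t where "j - k = 2 ^ n * t" using assms by (elim dvdE)
  then have "j = k + 2 ^ n * t" by simp
  then have "root2n n powi j = root2n n powi k * (root2n n powi (2 ^ n)) powi t"
    by (simp add: power_int_add power_int_mult)
  also have "root2n n powi (2 ^ n) = 1"
    using root2n_power_full[of n] by (metis of_nat_numeral of_nat_power power_int_of_nat)
  finally show ?thesis by simp
qed

lemma root2n_powi_half: "root2n (Suc n) powi (2 ^ n) = -1"
  using root2n_power_half[of n] by (metis of_nat_numeral of_nat_power power_int_of_nat)

lemma root2n_powi_double: "root2n (Suc n) powi (2 * j) = root2n n powi j"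
  unfolding power_int_mult using root2n_Suc_power2[of n] by simp

lemma odd_powi_half:
  assumes "odd j"
  shows "(root2n (Suc n) powi j) ^ (2 ^ n) = -1"
proof -
  have "(root2n (Suc n) powi j) ^ (2 ^ n) = (root2n (Suc n) powi (2 ^ n)) powi j"
    by (metis mult.commute of_nat_numeral of_nat_power power_int_mult power_int_of_nat)
  then show ?thesis using assms by (simp add: root2n_powi_half power_int_minus_left)
qed

lemma circular_d_minus: "circular_d n (-j) = circular_d n j"
  by (simp add: circular_d_def)

lemma circular_d_cong:
  assumes "2 ^ n dvd j - k \<or> 2 ^ n dvd j + k"
  shows "circular_d n j = circular_d n k"
proof -
  have *: "circular_d n j = circular_d n k" if "2 ^ n dvd j - k" for k
    using root2n_powi_cong[OF that] root2n_powi_cong[of n "-j" "-k"] that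
    by (simp add: circular_d_def dvd_diff_commute)
  show ?thesis using *[of k] *[of "-k"] assms by (auto simp: circular_d_minus)
qed

lemma circular_d_half:
  "circular_d (Suc n) (j + 2 ^ n) = 1 - root2n (Suc n) powi j - root2n (Suc n) powi (-j)"
proof -
  have "root2n (Suc n) powi (- j - 2 ^ n) = - (root2n (Suc n) powi (- j))"
    by (simp add: power_int_diff root2n_powi_half)
  then show ?thesis by (simp add: circular_d_def power_int_add root2n_powi_half)
qed

text \<open>The relative norm from one level to the one below: adding \<open>2^n\<close> to the exponent changes the
  sign of \<open>c = \<alpha>^j + \<alpha>^(-j)\<close>, and \<open>(1 + c) (1 - c) = - (1 + \<alpha>^(2j) + \<alpha>^(-2j))\<close>.\<close>

lemma circular_d_norm:
  "circular_d (Suc n) j * circular_d (Suc n) (j + 2 ^ n) = - circular_d n j"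
proof -
  define x where "x = root2n (Suc n) powi j"
  define y where "y = root2n (Suc n) powi (-j)"
  have xy: "x * y = 1" by (simp add: x_def y_def power_int_minus)
  have sq: "root2n n powi k = (root2n (Suc n) powi k) ^ 2" for k
    by (metis mult_2 power2_eq_square power_int_add root2n_nonzero root2n_powi_double)
  have "circular_d n j = 1 + x ^ 2 + y ^ 2"
    unfolding circular_d_def sq x_def y_def ..
  moreover have "(1 + x + y) * (1 - x - y) = - (1 + x ^ 2 + y ^ 2) + 2 * (1 - x * y)"
    by (simp add: algebra_simps power2_eq_square)
  ultimately show ?thesis
    unfolding circular_d_half circular_d_def[of "Suc n" j] by (simp add: xy flip: x_def y_def)
qed

lemma powi_odd_neq_1: "odd j \<Longrightarrow> root2n (Suc n) powi j \<noteq> 1"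
  using odd_powi_half[of j n] by force

text \<open>The factorisation of \<open>1 - x^3\<close>, which is why powers of \<open>3\<close> index everything that follows.\<close>

lemma circular_d_quotient:
  "circular_d n j * (root2n n powi j * (1 - root2n n powi j)) = 1 - root2n n powi (3 * j)"
proof -
  define x where "x = root2n n powi j"
  define y where "y = root2n n powi (-j)"
  have xy: "y * x = 1" by (simp add: x_def y_def power_int_minus)
  have x3: "root2n n powi (3 * j) = x ^ 3" unfolding x_def mult.commute[of 3] power_int_mult by simp
  have "(1 + x + y) * (x * (1 - x)) = (y * x) * (1 - x) + x - x ^ 3"
    by (simp add: algebra_simps power2_eq_square power3_eq_cube)
  also have "\<dots> = 1 - x ^ 3" by (simp add: xy)
  finally show ?thesis unfolding x3 circular_d_def x_def[symmetric] y_def[symmetric] .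
qed

lemma circular_d_nonzero: "odd j \<Longrightarrow> circular_d (Suc n) j \<noteq> 0"
  using circular_d_quotient[of "Suc n" j] powi_odd_neq_1[of "3 * j" n]
  by (metis even_mult_iff mult_zero_left odd_numeral right_minus_eq)

lemma circular_d_real: "circular_d n j \<in> \<real>"
proof -
  define z where "z = root2n n powi j"
  have "z * cnj z = 1"
    unfolding complex_norm_square[symmetric] z_def by (simp add: norm_power_int)
  then have "root2n n powi (-j) = cnj z"
    unfolding power_int_minus z_def by (metis inverse_unique)
  then have "circular_d n j = 1 + (z + cnj z)"
    by (simp add: circular_d_def z_def)
  then show ?thesis by (simp add: complex_add_cnj)
qed

section \<open>Logarithms of the \<open>d_j\<close> along the powers of \<open>3\<close>\<close>

definition log_d :: "nat \<Rightarrow> nat \<Rightarrow> real" where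
  "log_d n i = ln (norm (circular_d n (3 ^ i)))"

text \<open>Up to sign, \<open>3^(2^m)\<close> is the residue that generates the Galois group of one level over the level
  below. The sign is \<open>-1\<close> only for \<open>m = 0\<close>, where \<open>3 = -5\<close> modulo \<open>8\<close>; it is immaterial because
  \<open>d_(-j) = d_j\<close>.\<close>

lemma power3_half_period:
  "\<exists>e\<in>{1, -1::int}. 2 ^ (Suc (m + 2)) dvd 3 ^ (2 ^ m) - e * (1 + 2 ^ (m + 2))"
proof (cases m)
  case (Suc m')
  have "2 ^ (m' + 4) dvd (3::int) ^ (2 ^ Suc m') - (1 + 2 ^ (m' + 3))"
  proof (induction m')
    case (Suc k)
    then obtain t where "(3::int) ^ (2 ^ Suc k) - (1 + 2 ^ (k + 3)) = 2 ^ (k + 4) * t"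
      by (elim dvdE)
    then have t: "(3::int) ^ (2 ^ Suc k) = 1 + 2 ^ (k + 3) * (1 + 2 * t)"
      by (simp add: algebra_simps power_add)
    have "(3::int) ^ (2 ^ Suc (Suc k)) = (3 ^ (2 ^ Suc k)) ^ 2"
      by (simp flip: power_mult add: mult.commute)
    also have "\<dots> = 1 + 2 ^ (Suc k + 3) + 2 ^ (Suc k + 4) * (t + 2 ^ (k + 1) * (1 + 2 * t) ^ 2)"
      unfolding t by (simp add: algebra_simps power_add power2_eq_square)
    finally show ?case by simp
  qed simp
  moreover have "Suc (m + 2) = m' + 4" "m + 2 = m' + 3" using Suc by simp_all
  ultimately show ?thesis using Suc by (intro bexI[of _ 1]) (simp_all only: mult_1 insert_iff simp_thms)
qed simp

lemma circular_d_power3_shift: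
  "circular_d (Suc (m + 2)) (3 ^ (i + 2 ^ m)) = circular_d (Suc (m + 2)) (3 ^ i + 2 ^ (m + 2))"
proof -
  obtain e :: int where e: "e = 1 \<or> e = -1" "2 ^ (Suc (m + 2)) dvd 3 ^ (2 ^ m) - e * (1 + 2 ^ (m + 2))"
    using power3_half_period[of m] by blast
  obtain t where t: "(3::int) ^ i = 2 * t + 1" by (rule oddE[of "3 ^ i"]) simp_all
  have "2 ^ (Suc (m + 2)) dvd 3 ^ i * (3 ^ (2 ^ m) - e * (1 + 2 ^ (m + 2)))"
    using e(2) by simp
  moreover have "3 ^ i * (3 ^ (2 ^ m) - e * (1 + 2 ^ (m + 2))) =
      3 ^ (i + 2 ^ m) - e * (3 ^ i + 2 ^ (m + 2)) - 2 ^ (Suc (m + 2)) * (e * t)"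
    by (simp add: t algebra_simps power_add)
  ultimately have "2 ^ (Suc (m + 2)) dvd 3 ^ (i + 2 ^ m) - e * (3 ^ i + 2 ^ (m + 2))"
    by (metis dvd_triv_left dvd_diff_left_iff)
  then show ?thesis using e(1)
    by (intro circular_d_cong) (elim disjE; simp only: mult_1 mult_minus1 diff_minus_eq_add simp_thms)
qed

text \<open>In operator form: \<open>x^(2^m) + 1\<close> maps the sequence of one level to that of the level below.\<close>

lemma log_d_fold: "log_d (Suc (m + 2)) i + log_d (Suc (m + 2)) (i + 2 ^ m) = log_d (m + 2) i"
proof -
  have nz: "circular_d (Suc (m + 2)) j \<noteq> 0" if "odd j" for j
    by (rule circular_d_nonzero[OF that])
  have "norm (circular_d (m + 2) (3 ^ i)) = norm (circular_d (Suc (m + 2)) (3 ^ i) * circular_d (Suc (m + 2)) (3 ^ (i + 2 ^ m)))"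
    unfolding circular_d_power3_shift using circular_d_norm[of "m + 2" "3 ^ i"]
    by simp
  then show ?thesis unfolding log_d_def using nz[of "3 ^ i"] nz[of "3 ^ (i + 2 ^ m)"]
    by (simp add: norm_mult ln_mult)
qed

text \<open>Equality at \<open>0\<close> and \<open>2^m\<close> would read \<open>|1 + c| = |1 - c|\<close> with \<open>c = \<alpha> + 1/\<alpha>\<close> real, forcing
  \<open>c = 0\<close> and \<open>\<alpha>^2 = -1\<close>; the order of \<open>\<alpha>\<close> is at least \<open>8\<close>.\<close>

lemma log_d_not_periodic: "log_d (Suc (m + 2)) (2 ^ m) \<noteq> log_d (Suc (m + 2)) 0"
proof
  assume *: "log_d (Suc (m + 2)) (2 ^ m) = log_d (Suc (m + 2)) 0"
  have nz: "circular_d (Suc (m + 2)) j \<noteq> 0" if "odd j" for j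
    by (rule circular_d_nonzero[OF that])
  define x where "x = root2n (Suc (m + 2)) powi 1"
  define y where "y = root2n (Suc (m + 2)) powi (-1)"
  have xy: "x * y = 1" by (simp add: x_def y_def power_int_minus)
  from * have "norm (circular_d (Suc (m + 2)) (1 + 2 ^ (m + 2))) = norm (circular_d (Suc (m + 2)) 1)"
    using nz[of "1 + 2 ^ (m + 2)"] nz[of 1] circular_d_power3_shift[of m 0] by (simp add: log_d_def)
  moreover have "circular_d (Suc (m + 2)) (1 + 2 ^ (m + 2)) = 1 - x - y"
    using circular_d_half[of "m + 2" 1] by (simp add: x_def y_def)
  moreover have d1: "circular_d (Suc (m + 2)) 1 = 1 + x + y"
    unfolding circular_d_def x_def y_def ..
  moreover obtain a where a: "1 + x + y = of_real a"
    using circular_d_real[of "Suc (m + 2)" 1, unfolded d1] by (rule Reals_cases)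
  moreover have "1 - x - y = of_real (2 - a)" using a by (simp add: algebra_simps)
  ultimately have "norm (complex_of_real (2 - a)) = norm (complex_of_real a)" by (simp only:)
  then have "\<bar>2 - a\<bar> = \<bar>a\<bar>" by (simp only: norm_of_real)
  then have "a = 1" by linarith
  then have "x + y = 0" using a by (simp add: add.assoc)
  then have "x * x = -1" using xy by (metis add_eq_0_iff minus_equation_iff mult_minus_right)
  then have "root2n (Suc (m + 2)) ^ 2 = -1" by (simp add: x_def power2_eq_square)
  then have "root2n (m + 2) = -1" using root2n_Suc_power2[of "m + 2"] by simp
  then have "(-1::complex) ^ (2 ^ (m + 1)) = -1"
    using root2n_power_half[of "m + 1"] by simp
  then show False by simp
qed

lemma log_d_periodic: "log_d (m + 2) (i + 2 ^ m) = log_d (m + 2) i"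
proof -
  obtain e :: int where e: "e = 1 \<or> e = -1" "2 ^ (Suc (m + 2)) dvd 3 ^ (2 ^ m) - e * (1 + 2 ^ (m + 2))"
    using power3_half_period[of m] by blast
  have "2 ^ (m + 2) dvd 3 ^ (2 ^ m) - e * (1 + 2 ^ (m + 2))"
    using e(2) by (rule dvd_trans[rotated]) (simp add: le_imp_power_dvd)
  then have "2 ^ (m + 2) dvd 3 ^ (2 ^ m) - e * (1 + 2 ^ (m + 2)) + e * 2 ^ (m + 2)" by simp
  then have "2 ^ (m + 2) dvd 3 ^ (2 ^ m) - e" by (simp add: algebra_simps)
  then have "2 ^ (m + 2) dvd 3 ^ i * (3 ^ (2 ^ m) - e)" by (rule dvd_mult)
  then have "2 ^ (m + 2) dvd 3 ^ (i + 2 ^ m) - e * 3 ^ i" by (simp only: algebra_simps power_add)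
  then show ?thesis unfolding log_d_def using e(1)
    by (intro arg_cong[of _ _ "\<lambda>z. ln (norm z)"] circular_d_cong) (elim disjE; simp only: mult_1 mult_minus1 diff_minus_eq_add simp_thms)
qed

text \<open>The induction climbs the tower of fields using
  \<open>1 + x + \<dots> + x^(2M - 1) = (1 + x + \<dots> + x^(M - 1)) (x^M + 1)\<close>. The first factor divides \<open>f\<close> by the
  level below, the second one because otherwise the sequence of the upper level would be determined by
  that of the lower level and inherit its period.\<close>

lemma log_d_annihilator:
  assumes "\<And>k. shift_act f (log_d (m + 2)) k = 0"
  shows "(\<Sum>i<2 ^ m. Polynomial.monom 1 i) dvd f"
  using assms
proof (induction m arbitrary: f)
  case 0
  have "(\<Sum>i<2 ^ 0. Polynomial.monom 1 i) = (1 :: rat poly)"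
    by (simp add: Polynomial.monom_0)
  then show ?case by simp
next
  case (Suc m)
  define Phi where "Phi = (Polynomial.monom 1 (2 ^ m) + 1 :: rat poly)"
  define h where "h = (\<Sum>i<2 ^ m. Polynomial.monom 1 i :: rat poly)"
  let ?s = "log_d (Suc (m + 2))"
  have Phi_s: "shift_act Phi ?s = log_d (m + 2)"
    using log_d_fold[of m] by (intro ext) (simp add: Phi_def shift_act_add shift_act_monom add.commute)
  have f_s: "shift_act f ?s k = 0" for k using Suc.prems[of k] by simp
  have "shift_act f (log_d (m + 2)) k = 0" for k
  proof -
    have "shift_act (Phi * f) ?s k = 0"
      unfolding shift_act_mult using f_s by (rule shift_act_zero_seq)
    then show ?thesis by (simp only: mult.commute[of Phi] shift_act_mult Phi_s)
  qed
  then have hf: "h dvd f" unfolding h_def by (rule Suc.IH)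
  \<comment> \<open>If \<open>u f + v Phi = 1\<close>, then \<open>s = v (Phi s)\<close>, and \<open>Phi s\<close> has period \<open>2^m\<close>.\<close>
  have Phif: "Phi dvd f"
  proof (rule ccontr)
    assume "\<not> Phi dvd f"
    then obtain u v where uv: "u * f + v * Phi = 1"
      using power2_cyclotomic_bezout unfolding Phi_def by blast
    have s: "?s k = shift_act v (log_d (m + 2)) k" for k
    proof -
      have "?s k = shift_act (u * f + v * Phi) ?s k" by (simp add: uv)
      also have "\<dots> = shift_act v (log_d (m + 2)) k"
        by (simp only: shift_act_add shift_act_mult Phi_s shift_act_zero_seq[OF f_s] add_0)
      finally show ?thesis .
    qed
    have "?s (2 ^ m) = ?s 0"
      using log_d_periodic[of m] unfolding s by (simp add: shift_act_def add.commute)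
    then show False using log_d_not_periodic by blast
  qed
  have "coprime h Phi"
  proof -
    have "Polynomial.degree h < 2 ^ m"
      unfolding h_def by (intro degree_sum_less) (auto simp: degree_monom_eq)
    moreover have "Polynomial.degree Phi = 2 ^ m"
      unfolding Phi_def by (subst degree_add_eq_left) (simp_all add: degree_monom_eq)
    moreover have "h \<noteq> 0"
    proof
      assume "h = 0"
      then have "Polynomial.coeff h 0 = 0" by simp
      then show False by (simp add: h_def Polynomial.coeff_sum sum.delta)
    qed
    ultimately have "\<not> Phi dvd h" using divides_degree by fastforce
    then show ?thesis using power2_cyclotomic_irreducible[of m] unfolding Phi_def
      by (metis coprime_commute field_poly_irreducible_imp_prime prime_elem_imp_coprime)
  qed
  then have "h * Phi dvd f" using hf Phif by (rule divides_mult[rotated 2])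
  also have "h * Phi = (\<Sum>i<2 ^ Suc m. Polynomial.monom 1 i)"
  proof -
    have "(\<Sum>i<2 ^ Suc m. Polynomial.monom 1 i :: rat poly) =
       h + (\<Sum>i\<in>{2 ^ m..<2 ^ m + 2 ^ m}. Polynomial.monom 1 i)"
      unfolding h_def mult_2 power_Suc lessThan_atLeast0 by (rule sum.atLeastLessThan_concat[symmetric]) auto
    also have "(\<Sum>i\<in>{2 ^ m..<2 ^ m + 2 ^ m}. Polynomial.monom 1 i) = h * Polynomial.monom 1 (2 ^ m)"
      unfolding h_def using sum.shift_bounds_nat_ivl[of "\<lambda>i. Polynomial.monom (1::rat) i" 0 "2 ^ m" "2 ^ m"]
      by (simp add: sum_distrib_right mult_monom atLeast0LessThan)
    finally show ?thesis by (simp add: Phi_def algebra_simps)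
  qed
  finally show ?case .
qed

section \<open>Galois conjugation of multiplicative relations\<close>

text \<open>For \<open>z\<close> and \<open>w\<close> roots of \<open>x^(2^r) + 1\<close> this is the graph of the field automorphism that maps
  \<open>z\<close> to \<open>w\<close>. Working with the graph avoids choosing a polynomial representation of each element.\<close>

definition conjugates :: "complex \<Rightarrow> complex \<Rightarrow> complex \<Rightarrow> complex \<Rightarrow> bool" where
  "conjugates z w x y \<longleftrightarrow>
     (\<exists>f :: rat poly. x = poly (map_poly of_rat f) z \<and> y = poly (map_poly of_rat f) w)"

lemma conjugates_base: "conjugates z w z w"
  unfolding conjugates_def by (intro exI[of _ "[:0, 1:]"]) (simp add: map_poly_pCons)

lemma conjugates_1: "conjugates z w 1 1"
  unfolding conjugates_def by (intro exI[of _ 1]) simp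

lemma conjugates_minus_1: "conjugates z w (-1) (-1)"
  unfolding conjugates_def by (intro exI[of _ "[:-1:]"]) (simp add: map_poly_pCons)

lemma conjugates_add: "conjugates z w x y \<Longrightarrow> conjugates z w x' y' \<Longrightarrow> conjugates z w (x + x') (y + y')"
  unfolding conjugates_def by (metis of_rat_poly_add poly_add)

lemma conjugates_mult: "conjugates z w x y \<Longrightarrow> conjugates z w x' y' \<Longrightarrow> conjugates z w (x * x') (y * y')"
  unfolding conjugates_def by (metis of_rat_poly_mult poly_mult)

lemma poly_power2_cyclotomic:
  assumes "(z::complex) ^ (2 ^ r) = -1"
  shows "poly (map_poly of_rat (Polynomial.monom 1 (2 ^ r) + 1)) z = 0"
  using assms by (simp add: of_rat_poly_add map_poly_monom poly_monom)

text \<open>A polynomial that vanishes at \<open>z\<close> is a multiple of the irreducible \<open>x^(2^r) + 1\<close> and so vanishes at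
  \<open>w\<close> too.\<close>

lemma conjugates_unique:
  assumes z: "z ^ (2 ^ r) = -1" and w: "w ^ (2 ^ r) = -1"
      and xy: "conjugates z w x y" "conjugates z w x y'"
  shows "y = y'"
proof -
  define Phi where "Phi = (Polynomial.monom 1 (2 ^ r) + 1 :: rat poly)"
  obtain f g where f: "x = poly (map_poly of_rat f) z" "y = poly (map_poly of_rat f) w"
    and g: "x = poly (map_poly of_rat g) z" "y' = poly (map_poly of_rat g) w"
    using xy unfolding conjugates_def by blast
  define p where "p = f + [:-1:] * g"
  have p: "poly (map_poly of_rat p) t = poly (map_poly of_rat f) t - poly (map_poly of_rat g) t"
    for t :: complex
    unfolding p_def of_rat_poly_add of_rat_poly_mult by (simp add: map_poly_pCons)
  have "Phi dvd p"
  proof (rule ccontr)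
    assume "\<not> Phi dvd p"
    then obtain u v where "u * p + v * Phi = 1"
      using power2_cyclotomic_bezout unfolding Phi_def by blast
    then have "poly (map_poly of_rat (u * p + v * Phi)) z = 1" by simp
    then show False
      using poly_power2_cyclotomic[OF z] f g p[of z]
      by (simp add: of_rat_poly_add of_rat_poly_mult flip: Phi_def)
  qed
  then obtain q where "p = Phi * q" by (elim dvdE)
  then have "poly (map_poly of_rat p) w = 0"
    using poly_power2_cyclotomic[OF w] by (simp add: of_rat_poly_mult flip: Phi_def)
  then show ?thesis using p[of w] f g by simp
qed

text \<open>A Bezout relation \<open>u f + v (x^(2^r) + 1) = 1\<close> makes \<open>u\<close> represent the inverses at \<open>z\<close> and at
  \<open>w\<close> simultaneously.\<close>

lemma conjugates_inverse:
  assumes z: "z ^ (2 ^ r) = -1" and w: "w ^ (2 ^ r) = -1"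
      and xy: "conjugates z w x y" and x: "x \<noteq> 0"
  shows "conjugates z w (inverse x) (inverse y)"
proof -
  define Phi where "Phi = (Polynomial.monom 1 (2 ^ r) + 1 :: rat poly)"
  note Phi0 = poly_power2_cyclotomic[OF z, folded Phi_def] poly_power2_cyclotomic[OF w, folded Phi_def]
  obtain f where f: "x = poly (map_poly of_rat f) z" "y = poly (map_poly of_rat f) w"
    using xy unfolding conjugates_def by blast
  have "\<not> Phi dvd f"
    using x Phi0(1) unfolding f by (auto elim!: dvdE simp: of_rat_poly_mult)
  then obtain u v where uv: "u * f + v * Phi = 1"
    using power2_cyclotomic_bezout unfolding Phi_def by blast
  have "poly (map_poly of_rat u) t * poly (map_poly of_rat f) t = 1"
    if "poly (map_poly of_rat Phi) t = 0" for t :: complex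
  proof -
    have "poly (map_poly of_rat (u * f + v * Phi)) t = 1" by (simp add: uv)
    then show ?thesis using that by (simp add: of_rat_poly_add of_rat_poly_mult)
  qed
  from this[OF Phi0(1)] this[OF Phi0(2)] show ?thesis
    unfolding conjugates_def f by (metis inverse_unique mult.commute)
qed

lemma conjugates_powi:
  assumes z: "z ^ (2 ^ r) = -1" and w: "w ^ (2 ^ r) = -1"
      and xy: "conjugates z w x y" and x: "x \<noteq> 0"
  shows "conjugates z w (x powi k) (y powi k)"
proof -
  have pow: "conjugates z w (u ^ m) (v ^ m)" if "conjugates z w u v" for u v m
    by (induction m) (simp_all add: conjugates_1 conjugates_mult that)
  show ?thesis
    using pow[OF xy] pow[OF conjugates_inverse[OF assms]] by (simp add: power_int_def)
qed

lemma conjugates_prod: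
  "(\<And>i. i \<in> I \<Longrightarrow> conjugates z w (f i) (g i)) \<Longrightarrow> conjugates z w (prod f I) (prod g I)"
  by (induction I rule: infinite_finite_induct) (simp_all add: conjugates_1 conjugates_mult)

lemma conjugates_circular_d:
  assumes "odd k"
  shows "conjugates (root2n (Suc n)) (root2n (Suc n) powi k) (circular_d (Suc n) j) (circular_d (Suc n) (j * k))"
proof -
  note zw = root2n_power_half[of n] odd_powi_half[OF assms, of n]
  have "conjugates (root2n (Suc n)) (root2n (Suc n) powi k) (root2n (Suc n) powi i) (root2n (Suc n) powi (i * k))" for i
    using conjugates_powi[OF zw conjugates_base, of i] by (simp add: mult.commute[of i] flip: power_int_mult)
  from this[of j] this[of "-j"] show ?thesis
    unfolding circular_d_def by (intro conjugates_add conjugates_1) simp_all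
qed

lemma circular_d_relation_conjugate:
  assumes k: "odd k" and odd: "\<And>i. i \<in> I \<Longrightarrow> odd (j i)"
      and rel: "(\<Prod>i\<in>I. circular_d (Suc n) (j i) powi a i) \<in> {1, -1}"
  shows "(\<Prod>i\<in>I. circular_d (Suc n) (j i * k) powi a i) \<in> {1, -1}"
proof -
  note zw = root2n_power_half[of n] odd_powi_half[OF k, of n]
  have *: "conjugates (root2n (Suc n)) (root2n (Suc n) powi k)
       (\<Prod>i\<in>I. circular_d (Suc n) (j i) powi a i) (\<Prod>i\<in>I. circular_d (Suc n) (j i * k) powi a i)"
    by (intro conjugates_prod conjugates_powi[OF zw] conjugates_circular_d k circular_d_nonzero odd)
  from rel consider "(\<Prod>i\<in>I. circular_d (Suc n) (j i) powi a i) = 1"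
    | "(\<Prod>i\<in>I. circular_d (Suc n) (j i) powi a i) = -1" by blast
  then show ?thesis
  proof cases
    case 1
    show ?thesis using conjugates_unique[OF zw *[unfolded 1] conjugates_1] by simp
  next
    case 2
    show ?thesis using conjugates_unique[OF zw *[unfolded 2] conjugates_minus_1] by simp
  qed
qed

section \<open>Odd residues modulo a power of two, up to sign\<close>

text \<open>In \<open>3^(2j) - 1 = (3^j - 1) (3^j + 1)\<close> the second factor is twice an odd number if \<open>j\<close> is even, so
  halving the exponent loses exactly one power of \<open>2\<close>. Odd \<open>j\<close> are excluded modulo \<open>16\<close>.\<close>

lemma power3_order:
  assumes "2 ^ (m + 3) dvd (3::int) ^ k - 1"
  shows "2 ^ Suc m dvd k"
  using assms
proof (induction m arbitrary: k)
  case 0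
  show ?case
  proof (rule ccontr)
    assume "\<not> 2 ^ Suc 0 dvd k"
    then obtain j where "k = 2 * j + 1" by (auto elim: oddE)
    then have "(3::int) ^ k = 3 * 9 ^ j" by (simp add: power_mult)
    moreover have "(9::int) ^ j mod 8 = 1" by (simp add: power_mod[of 9 8 j, symmetric])
    ultimately show False using 0 by (simp add: mod_eq_dvd_iff[symmetric]) presburger
  qed
next
  case (Suc m)
  have "2 ^ (m + 3) dvd (3::int) ^ k - 1"
    using Suc.prems by (rule dvd_trans[rotated]) (simp add: le_imp_power_dvd)
  then have "2 ^ Suc m dvd k" by (rule Suc.IH)
  then have "even k" by auto
  then obtain j where k: "k = 2 * j" by (elim evenE)
  have fact: "(3::int) ^ k - 1 = (3 ^ j - 1) * (3 ^ j + 1)"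
    unfolding k mult_2 power_add by (simp add: algebra_simps)
  have "even j"
  proof (rule ccontr)
    assume "odd j"
    then obtain i where "j = 2 * i + 1" by (elim oddE)
    then have "(3::int) ^ k = 9 * 81 ^ i" by (simp add: k power_mult flip: power_mult_distrib)
    moreover have "(81::int) ^ i mod 16 = 1" by (simp add: power_mod[of 81 16 i, symmetric])
    moreover have "(16::int) dvd 3 ^ k - 1"
      using Suc.prems by (rule dvd_trans[rotated]) (simp add: power_add)
    ultimately show False by presburger
  qed
  then obtain i where "j = 2 * i" by (elim evenE)
  then have "(3::int) ^ j = 9 ^ i" by (simp add: power_mult)
  moreover have "(9::int) ^ i mod 4 = 1" by (simp add: power_mod[of 9 4 i, symmetric])
  then have "(9::int) ^ i = 4 * (9 ^ i div 4) + 1" by presburger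
  moreover define t :: int where "t = 2 * (9 ^ i div 4) + 1"
  ultimately have t: "(3::int) ^ j + 1 = 2 * t" "odd t" by simp_all
  have "2 * 2 ^ (m + 3) dvd 2 * (((3::int) ^ j - 1) * t)"
    using Suc.prems unfolding fact t(1) by (simp only: add_Suc power_Suc mult.left_commute)
  then have "2 ^ (m + 3) dvd ((3::int) ^ j - 1) * t"
    unfolding dvd_mult_cancel_left by simp
  moreover have "coprime (2 ^ (m + 3)) t" using t(2) by simp
  ultimately have "2 ^ (m + 3) dvd (3::int) ^ j - 1"
    by (simp add: coprime_dvd_mult_left_iff)
  then have "2 ^ Suc m dvd j" by (rule Suc.IH)
  then show ?case by (simp add: k)
qed

lemma power3_order_pm:
  assumes "2 ^ (m + 2) dvd (3::int) ^ k - 1 \<or> 2 ^ (m + 2) dvd (3::int) ^ k + 1"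
  shows "2 ^ m dvd k"
proof (cases m)
  case (Suc m')
  have "\<not> 8 dvd (3::int) ^ k + 1"
  proof -
    have "(9::int) ^ (k div 2) mod 8 = 1" by (simp add: power_mod[of 9 8, symmetric])
    moreover have "(3::int) ^ k = 9 ^ (k div 2) \<or> (3::int) ^ k = 3 * 9 ^ (k div 2)"
    proof -
      have "(3::int) ^ (2 * q) = 9 ^ q" "(3::int) ^ (2 * q + 1) = 3 * 9 ^ q" for q
        by (simp_all add: power_mult)
      then show ?thesis
        by (metis even_two_times_div_two odd_two_times_div_two_succ)
    qed
    moreover have "\<not> 8 dvd x + 1" if "y mod 8 = 1" "x = y \<or> x = 3 * y" for x y :: int
    proof -
      define s where "s = y div 8"
      have "y = 8 * s + 1" using that(1) unfolding s_def by (metis mult_div_mod_eq)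
      then have "x + 1 = 8 * s + 2 \<or> x + 1 = 8 * (3 * s) + 4" using that(2) by auto
      then show ?thesis by (elim disjE) (simp_all only: dvd_add_right_iff[OF dvd_triv_left], simp_all)
    qed
    ultimately show ?thesis by blast
  qed
  moreover have "(8::int) dvd 2 ^ (m + 2)" by (simp add: Suc power_add)
  ultimately have "\<not> 2 ^ (m + 2) dvd (3::int) ^ k + 1" by (metis dvd_trans)
  then show ?thesis using assms power3_order[of m' k] Suc by (simp add: numeral_3_eq_3)
qed simp

text \<open>The representatives are the \<open>2^m\<close> odd numbers below \<open>2^(m + 1)\<close>, half of the modulus; an odd
  residue in the upper half is replaced by its negative.\<close>

lemma odd_representative:
  assumes "odd (j::int)"
  shows "\<exists>l<2 ^ m. 2 ^ (m + 2) dvd j - (2 * int l + 1) \<or> 2 ^ (m + 2) dvd j + (2 * int l + 1)"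
proof -
  define M where "M = (2::int) ^ m"
  have M: "(2::int) ^ (m + 2) = 4 * M" "M > 0" by (simp_all add: M_def power_add)
  define r where "r = j mod (4 * M)"
  have r: "0 \<le> r" "r < 4 * M" using M by (simp_all add: r_def)
  have "4 * M dvd j - r" by (simp add: r_def)
  then obtain t where "j - r = 4 * M * t" by (elim dvdE)
  then have t: "j = r + 4 * M * t" by simp
  then have "odd r" using assms by simp
  then obtain l where l: "r = 2 * l + 1" by (elim oddE)
  show ?thesis
  proof (cases "l < M")
    case True
    have "int (nat l) = l" using r l by simp
    moreover have "nat l < 2 ^ m" using True r l by (simp add: M_def nat_less_iff)
    ultimately show ?thesis unfolding M
      by (intro exI[of _ "nat l"]) (simp add: t l)
  next
    case False
    define l' where "l' = 2 * M - 1 - l"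
    have l': "0 \<le> l'" "l' < M" using False r l by (simp_all add: l'_def)
    have "int (nat l') = l'" using l' by simp
    moreover have "nat l' < 2 ^ m" using l' by (simp add: M_def nat_less_iff)
    moreover have "j + (2 * l' + 1) = 4 * M * (t + 1)"
      by (simp add: t l l'_def algebra_simps)
    ultimately show ?thesis unfolding M
      by (intro exI[of _ "nat l'"]) (metis dvd_triv_left)
  qed
qed

text \<open>Modulo sign there are \<open>2^m\<close> odd residues, and \<open>3\<close> has order \<open>2^m\<close> among them. It therefore
  suffices to see that distinct exponents below \<open>2^m\<close> give distinct representatives.\<close>

lemma power3_reindexing:
  "\<exists>\<pi>. bij_betw \<pi> {..<2 ^ m} {..<2 ^ m} \<and>
    (\<forall>i. 2 ^ (m + 2) dvd (3::int) ^ i - (2 * int (\<pi> i) + 1)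
       \<or> 2 ^ (m + 2) dvd (3::int) ^ i + (2 * int (\<pi> i) + 1))"
proof -
  have "\<exists>l<2 ^ m. 2 ^ (m + 2) dvd (3::int) ^ i - (2 * int l + 1)
                     \<or> 2 ^ (m + 2) dvd (3::int) ^ i + (2 * int l + 1)" for i
    by (rule odd_representative) simp
  then obtain \<pi> where \<pi>: "\<And>i. \<pi> i < 2 ^ m"
    "\<And>i. 2 ^ (m + 2) dvd (3::int) ^ i - (2 * int (\<pi> i) + 1)
                     \<or> 2 ^ (m + 2) dvd (3::int) ^ i + (2 * int (\<pi> i) + 1)"
    by metis
  have eq: "i = j" if ij: "\<pi> i = \<pi> j" "i \<le> j" "j < 2 ^ m" for i j
  proof -
    have "2 ^ (m + 2) dvd (3::int) ^ j - 3 ^ i \<or> 2 ^ (m + 2) dvd (3::int) ^ j + 3 ^ i"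
    proof -
      define c where "c = 2 * int (\<pi> i) + 1"
      consider "2 ^ (m + 2) dvd (3::int) ^ j - c" "2 ^ (m + 2) dvd (3::int) ^ i - c"
        | "2 ^ (m + 2) dvd (3::int) ^ j - c" "2 ^ (m + 2) dvd (3::int) ^ i + c"
        | "2 ^ (m + 2) dvd (3::int) ^ j + c" "2 ^ (m + 2) dvd (3::int) ^ i - c"
        | "2 ^ (m + 2) dvd (3::int) ^ j + c" "2 ^ (m + 2) dvd (3::int) ^ i + c"
        using \<pi>(2)[of i, folded c_def] \<pi>(2)[of j, folded ij(1), folded c_def] by blast
      then show ?thesis
      proof cases
        case 1 then show ?thesis using dvd_diff[OF 1] by simp
      next
        case 2 then show ?thesis using dvd_add[OF 2] by simp
      next
        case 3 then show ?thesis using dvd_add[OF 3] by simp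
      next
        case 4 then show ?thesis using dvd_diff[OF 4] by simp
      qed
    qed
    moreover have "(3::int) ^ j = 3 ^ i * 3 ^ (j - i)" using ij(2) by (simp flip: power_add)
    ultimately have "2 ^ (m + 2) dvd (3::int) ^ i * (3 ^ (j - i) - 1) \<or> 2 ^ (m + 2) dvd (3::int) ^ i * (3 ^ (j - i) + 1)"
      by (simp add: algebra_simps)
    moreover have "coprime (2 ^ (m + 2)) ((3::int) ^ i)"
      by (simp only: coprime_power_left_iff coprime_left_2_iff_odd) simp
    ultimately have "2 ^ (m + 2) dvd (3::int) ^ (j - i) - 1 \<or> 2 ^ (m + 2) dvd (3::int) ^ (j - i) + 1"
      by (simp only: coprime_dvd_mult_right_iff)
    then have "2 ^ m dvd j - i" by (rule power3_order_pm)
    then show ?thesis using ij by (metis diff_is_0_eq dvd_imp_le le_antisym less_imp_diff_less linorder_not_le neq0_conv)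
  qed
  have "inj_on \<pi> {..<2 ^ m}"
    by (rule inj_onI) (metis eq lessThan_iff linorder_le_cases)
  then have "bij_betw \<pi> {..<2 ^ m} {..<2 ^ m}"
    unfolding bij_betw_def by (intro conjI endo_inj_surj) (use \<pi>(1) in auto)
  then show ?thesis using \<pi>(2) by blast
qed

section \<open>Multiplicative independence of the \<open>d_j\<close>\<close>

lemma ln_norm_prod_powi:
  assumes "\<And>i. i \<in> I \<Longrightarrow> f i \<noteq> (0::complex)"
  shows "ln (norm (\<Prod>i\<in>I. f i powi a i)) = (\<Sum>i\<in>I. of_int (a i) * ln (norm (f i)))"
proof -
  have "ln (norm (\<Prod>i\<in>I. f i powi a i)) = ln (\<Prod>i\<in>I. norm (f i) powr of_int (a i))"
    using assms by (simp add: norm_power_int powr_real_of_int' flip: prod_norm)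
  also have "\<dots> = (\<Sum>i\<in>I. ln (norm (f i) powr of_int (a i)))"
    using assms by (cases "finite I") (simp_all add: ln_prod)
  also have "\<dots> = (\<Sum>i\<in>I. of_int (a i) * ln (norm (f i)))"
    using assms by (intro sum.cong) (simp_all add: ln_powr)
  finally show ?thesis .
qed

text \<open>Conjugating the relation by \<open>\<alpha> \<mapsto> \<alpha>^(3^k)\<close> for all \<open>k\<close> and taking logarithms of absolute values
  turns it into the statement that the polynomial with the exponents as coefficients, listed along
  the powers of \<open>3\<close>, annihilates the sequence \<open>log_d\<close>.\<close>

theorem circular_d_independent:
  fixes a :: "nat \<Rightarrow> int"
  assumes rel: "(\<Prod>l<2 ^ m - 1. circular_d (m + 2) (2 * int l + 1) powi a l) \<in> {1, -1}"
  shows "l < 2 ^ m - 1 \<Longrightarrow> a l = 0"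
proof -
  \<comment> \<open>The omitted element \<open>d_(2^(m + 1) - 1)\<close> is given the exponent \<open>0\<close>.\<close>
  define b where "b l = (if l < 2 ^ m - 1 then a l else 0)" for l
  have n: "m + 2 = Suc (m + 1)" by simp
  have "(\<Prod>l<2 ^ m - 1. circular_d (m + 2) (2 * int l + 1) powi a l)
      = (\<Prod>l<2 ^ m. circular_d (m + 2) (2 * int l + 1) powi b l)"
    by (intro prod.mono_neutral_cong_left) (auto simp: b_def)
  then have rel': "(\<Prod>l<2 ^ m. circular_d (Suc (m + 1)) (2 * int l + 1) powi b l) \<in> {1, -1}"
    using rel unfolding n by simp
  obtain \<pi> where \<pi>: "bij_betw \<pi> {..<2 ^ m} {..<2 ^ m}"
    "\<And>i. 2 ^ (m + 2) dvd (3::int) ^ i - (2 * int (\<pi> i) + 1)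
       \<or> 2 ^ (m + 2) dvd (3::int) ^ i + (2 * int (\<pi> i) + 1)"
    using power3_reindexing[of m] by blast
  define f where "f = (\<Sum>i<2 ^ m. Polynomial.monom (rat_of_int (b (\<pi> i))) i)"
  define h where "h = (\<Sum>i<2 ^ m. Polynomial.monom (1::rat) i)"
  have coeff_f: "Polynomial.coeff f i = (if i < 2 ^ m then of_int (b (\<pi> i)) else 0)" for i
    by (simp add: f_def Polynomial.coeff_sum sum.delta)
  have coeff_h: "Polynomial.coeff h i = (if i < 2 ^ m then 1 else 0)" for i
    by (simp add: h_def Polynomial.coeff_sum sum.delta)
  have "shift_act f (log_d (m + 2)) k = 0" for k
  proof -
    have "(\<Prod>l<2 ^ m. circular_d (Suc (m + 1)) ((2 * int l + 1) * 3 ^ k) powi b l) \<in> {1, -1}"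
      by (rule circular_d_relation_conjugate[OF _ _ rel']) simp_all
    also have "(\<Prod>l<2 ^ m. circular_d (Suc (m + 1)) ((2 * int l + 1) * 3 ^ k) powi b l) =
      (\<Prod>i<2 ^ m. circular_d (Suc (m + 1)) ((2 * int (\<pi> i) + 1) * 3 ^ k) powi b (\<pi> i))"
      by (rule prod.reindex_bij_betw[OF \<pi>(1), symmetric])
    also have "\<dots> = (\<Prod>i<2 ^ m. circular_d (Suc (m + 1)) (3 ^ (k + i)) powi b (\<pi> i))"
    proof (intro prod.cong refl arg_cong[of _ _ "\<lambda>z. z powi _"])
      fix i :: nat
      have "2 ^ (m + 2) dvd 3 ^ k * ((3::int) ^ i - (2 * int (\<pi> i) + 1))
                     \<or> 2 ^ (m + 2) dvd 3 ^ k * ((3::int) ^ i + (2 * int (\<pi> i) + 1))"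
        using \<pi>(2)[of i] by (meson dvd_mult)
      then have "2 ^ Suc (m + 1) dvd (3::int) ^ (k + i) - (2 * int (\<pi> i) + 1) * 3 ^ k
                     \<or> 2 ^ Suc (m + 1) dvd (3::int) ^ (k + i) + (2 * int (\<pi> i) + 1) * 3 ^ k"
        by (simp add: algebra_simps power_add)
      then show "circular_d (Suc (m + 1)) ((2 * int (\<pi> i) + 1) * 3 ^ k) = circular_d (Suc (m + 1)) (3 ^ (k + i))"
        by (rule circular_d_cong[symmetric])
    qed
    finally have "norm (\<Prod>i<2 ^ m. circular_d (Suc (m + 1)) (3 ^ (k + i)) powi b (\<pi> i)) = 1"
      by auto
    then have "ln (norm (\<Prod>i<2 ^ m. circular_d (Suc (m + 1)) (3 ^ (k + i)) powi b (\<pi> i))) = 0"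
      by (simp only: ln_one)
    also have "ln (norm (\<Prod>i<2 ^ m. circular_d (Suc (m + 1)) (3 ^ (k + i)) powi b (\<pi> i))) =
        (\<Sum>i<2 ^ m. of_int (b (\<pi> i)) * log_d (m + 2) (k + i))"
      unfolding log_d_def n by (rule ln_norm_prod_powi) (rule circular_d_nonzero, simp)
    finally show ?thesis
      by (simp add: f_def shift_act_sum shift_act_monom)
  qed
  then have "h dvd f" unfolding h_def by (rule log_d_annihilator)
  then obtain c where c: "f = h * c" by (elim dvdE)
  \<comment> \<open>The cofactor \<open>c\<close> is constant for reasons of degree, and the coefficient of \<open>f\<close> at the omitted element is \<open>0\<close>.\<close>
  have "f = 0"
  proof (rule ccontr)
    assume f0: "f \<noteq> 0"
    then have h0: "h \<noteq> 0" "c \<noteq> 0" using c by auto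
    have "Polynomial.degree f \<le> 2 ^ m - 1" by (rule Polynomial.degree_le) (auto simp: coeff_f)
    moreover have "Polynomial.degree h \<ge> 2 ^ m - 1" by (rule Polynomial.le_degree) (simp add: coeff_h)
    ultimately have "Polynomial.degree c = 0"
      using h0 by (simp add: c degree_mult_eq)
    then obtain c0 where c0: "c = [:c0:]" by (rule degree_eq_zeroE)
    have "2 ^ m - 1 \<in> \<pi> ` {..<2 ^ m}" using \<pi>(1) by (simp add: bij_betw_def)
    then obtain i where i: "i < 2 ^ m" "\<pi> i = 2 ^ m - 1" by auto
    then have "Polynomial.coeff f i = 0" by (simp add: coeff_f b_def)
    then have "c0 = 0" using i by (simp add: c c0 coeff_h)
    then show False using h0 c0 by simp
  qed
  assume l: "l < 2 ^ m - 1"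
  then have "l \<in> \<pi> ` {..<2 ^ m}" using \<pi>(1) by (simp add: bij_betw_def)
  then obtain i where i: "i < 2 ^ m" "\<pi> i = l" by auto
  have "Polynomial.coeff f i = 0" using \<open>f = 0\<close> by simp
  then show "a l = 0" using i l by (simp add: coeff_f b_def)
qed

section \<open>Subgroups of the multiplicative group of the cyclotomic field\<close>

text \<open>Closure under the operations of the complex numbers. This keeps the carrier of the cyclotomic group
  out of the computations; \<open>mult_closed_subgroup\<close> translates back. Zero may belong to such a set,
  as it does for the real numbers.\<close>

definition mult_closed :: "complex set \<Rightarrow> bool" where
  "mult_closed S \<longleftrightarrow> 1 \<in> S \<and> (\<forall>x\<in>S. \<forall>y\<in>S. x * y \<in> S) \<and> (\<forall>x\<in>S. inverse x \<in> S)"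

lemma mult_closedI:
  assumes "1 \<in> S" "\<And>x y. x \<in> S \<Longrightarrow> y \<in> S \<Longrightarrow> x * y \<in> S" "\<And>x. x \<in> S \<Longrightarrow> inverse x \<in> S"
  shows "mult_closed S"
  using assms by (auto simp: mult_closed_def)

lemma mult_closedD:
  assumes "mult_closed S"
  shows "1 \<in> S" "x \<in> S \<Longrightarrow> y \<in> S \<Longrightarrow> x * y \<in> S" "x \<in> S \<Longrightarrow> inverse x \<in> S"
  using assms by (auto simp: mult_closed_def)

lemma mult_closed_divide:
  "mult_closed S \<Longrightarrow> x \<in> S \<Longrightarrow> y \<in> S \<Longrightarrow> x / y \<in> S"
  unfolding divide_inverse by (intro mult_closedD)

lemma mult_closed_powi:
  assumes "mult_closed S" "x \<in> S"
  shows "x powi k \<in> S"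
proof -
  have "y ^ i \<in> S" if "y \<in> S" for y i
    using that by (induction i) (auto intro: mult_closedD[OF assms(1)])
  then show ?thesis using assms by (simp add: power_int_def mult_closedD(3))
qed

lemma mult_closed_prod:
  assumes "mult_closed S" "\<And>i. i \<in> I \<Longrightarrow> f i \<in> S"
  shows "prod f I \<in> S"
  using assms(2) by (induction I rule: infinite_finite_induct) (auto intro: mult_closedD[OF assms(1)])

lemma mult_closed_Int: "mult_closed A \<Longrightarrow> mult_closed B \<Longrightarrow> mult_closed (A \<inter> B)"
  by (auto simp: mult_closed_def)

lemma mult_closed_Reals: "mult_closed \<real>"
  by (auto simp: mult_closed_def)

lemma mult_closed_times:
  assumes "mult_closed A" "mult_closed B"
  shows "mult_closed {x * y |x y. x \<in> A \<and> y \<in> B}"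
proof (rule mult_closedI)
  show "1 \<in> {x * y |x y. x \<in> A \<and> y \<in> B}"
    using assms by (auto simp: mult_closed_def intro!: exI[of _ 1])
next
  fix x y assume "x \<in> {x * y |x y. x \<in> A \<and> y \<in> B}" "y \<in> {x * y |x y. x \<in> A \<and> y \<in> B}"
  then obtain a b a' b' where "x = a * b" "y = a' * b'" "a \<in> A" "b \<in> B" "a' \<in> A" "b' \<in> B"
    by blast
  then have "x * y = (a * a') * (b * b')" "a * a' \<in> A" "b * b' \<in> B"
    using assms by (simp_all add: mult_closedD)
  then show "x * y \<in> {x * y |x y. x \<in> A \<and> y \<in> B}" by blast
next
  fix x assume "x \<in> {x * y |x y. x \<in> A \<and> y \<in> B}"
  then obtain a b where "x = a * b" "a \<in> A" "b \<in> B" by blast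
  then have "inverse x = inverse a * inverse b" "inverse a \<in> A" "inverse b \<in> B"
    using assms by (simp_all add: mult_closedD)
  then show "inverse x \<in> {x * y |x y. x \<in> A \<and> y \<in> B}" by blast
qed

definition power_products :: "'i set \<Rightarrow> ('i \<Rightarrow> complex) \<Rightarrow> complex set" where
  "power_products I f = {\<Prod>i\<in>I. f i powi a i |a. True}"

lemma power_products_mult_closed:
  assumes "\<And>i. i \<in> I \<Longrightarrow> f i \<noteq> 0"
  shows "mult_closed (power_products I f)"
proof (rule mult_closedI)
  have "1 = (\<Prod>i\<in>I. f i powi 0)" by simp
  then show "1 \<in> power_products I f" unfolding power_products_def by fast
next
  fix x y assume "x \<in> power_products I f" "y \<in> power_products I f"
  then obtain a b where "x = (\<Prod>i\<in>I. f i powi a i)" "y = (\<Prod>i\<in>I. f i powi b i)"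
    unfolding power_products_def by blast
  then have "x * y = (\<Prod>i\<in>I. f i powi (a i + b i))"
    using assms by (simp add: power_int_add flip: prod.distrib)
  then show "x * y \<in> power_products I f" unfolding power_products_def by fast
next
  fix x assume "x \<in> power_products I f"
  then obtain a where "x = (\<Prod>i\<in>I. f i powi a i)"
    unfolding power_products_def by blast
  then have "inverse x = (\<Prod>i\<in>I. f i powi (- a i))"
    by (simp add: power_int_minus flip: prod_inversef)
  then show "inverse x \<in> power_products I f" unfolding power_products_def by fast
qed

lemma power_products_base:
  assumes "finite I" "i \<in> I"
  shows "f i \<in> power_products I f"
proof -
  have "(\<Prod>j\<in>I. f j powi (if j = i then 1 else 0)) = (\<Prod>j\<in>I. if j = i then f j else 1)"
    by (intro prod.cong) auto
  also have "\<dots> = f i" using assms by (simp add: prod.delta')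
  finally show ?thesis unfolding power_products_def
    by (intro CollectI exI[of _ "\<lambda>j. if j = i then 1 else 0"]) simp
qed

lemma power_products_subset:
  assumes "mult_closed S" "\<And>i. i \<in> I \<Longrightarrow> f i \<in> S"
  shows "power_products I f \<subseteq> S"
  using assms by (auto simp: power_products_def intro!: mult_closed_prod mult_closed_powi)

lemma cyclotomic_group_comm_group: "comm_group (cyclotomic_group n)"
proof -
  interpret C: field complex_field by (rule field_from_type_algebra)
  interpret F: field "cyclotomic_field n"
    unfolding cyclotomic_field_def
    by (rule C.generate_field_is_field) (simp add: ring_of_type_algebra_def)
  interpret M: group "cyclotomic_group n" by (rule F.field_mult_group)
  show ?thesis
    by (rule M.group_comm_groupI) (simp add: cyclotomic_field_def ring_of_type_algebra_def)
qed

lemma cyclotomic_field_simps [simp]: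
  "x \<otimes>\<^bsub>cyclotomic_field n\<^esub> y = x * y"
  "\<one>\<^bsub>cyclotomic_field n\<^esub> = 1"
  "\<zero>\<^bsub>cyclotomic_field n\<^esub> = 0"
  by (simp_all add: cyclotomic_field_def ring_of_type_algebra_def)

lemma cyclotomic_group_carrier:
  "carrier (cyclotomic_group n) = generate_field complex_field {root2n n} - {0}"
  by (simp add: cyclotomic_field_def ring_of_type_algebra_def)

lemma cyclotomic_group_inv:
  assumes "x \<in> carrier (cyclotomic_group n)"
  shows "inv\<^bsub>cyclotomic_group n\<^esub> x = inverse x"
proof -
  interpret comm_group "cyclotomic_group n" by (rule cyclotomic_group_comm_group)
  have "x * inv\<^bsub>cyclotomic_group n\<^esub> x = 1" using r_inv[OF assms] by simp
  then show ?thesis by (metis inverse_unique)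
qed

lemma cyclotomic_group_carrier_mult_closed: "mult_closed (carrier (cyclotomic_group n))"
proof -
  interpret comm_group "cyclotomic_group n" by (rule cyclotomic_group_comm_group)
  show ?thesis
  proof (rule mult_closedI)
    show "inverse x \<in> carrier (cyclotomic_group n)" if "x \<in> carrier (cyclotomic_group n)" for x
      using inv_closed[OF that] unfolding cyclotomic_group_inv[OF that] .
    show "1 \<in> carrier (cyclotomic_group n)"
      using one_closed by simp
    show "x * y \<in> carrier (cyclotomic_group n)"
      if "x \<in> carrier (cyclotomic_group n)" "y \<in> carrier (cyclotomic_group n)" for x y
      using m_closed[OF that] by simp
  qed
qed

lemma generate_mult_closed:
  assumes "A \<subseteq> carrier (cyclotomic_group n)"
  shows "mult_closed (generate (cyclotomic_group n) A)"
proof -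
  interpret comm_group "cyclotomic_group n" by (rule cyclotomic_group_comm_group)
  show ?thesis
  proof (rule mult_closedI)
    show "1 \<in> generate (cyclotomic_group n) A"
      using generate.one[of "cyclotomic_group n" A] by simp
    show "x * y \<in> generate (cyclotomic_group n) A"
      if "x \<in> generate (cyclotomic_group n) A" "y \<in> generate (cyclotomic_group n) A" for x y
      using generate.eng[OF that] by simp
    show "inverse x \<in> generate (cyclotomic_group n) A"
      if "x \<in> generate (cyclotomic_group n) A" for x
      using generate_m_inv_closed[OF assms that] generate_in_carrier[OF assms that]
      by (simp add: cyclotomic_group_inv)
  qed
qed

lemma generate_subset_mult_closed:
  assumes "A \<subseteq> carrier (cyclotomic_group n)" "A \<subseteq> S" "mult_closed S"
  shows "generate (cyclotomic_group n) A \<subseteq> S"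
proof
  fix x assume "x \<in> generate (cyclotomic_group n) A"
  then show "x \<in> S"
  proof induction
    case (inv h)
    then have "inv\<^bsub>cyclotomic_group n\<^esub> h = inverse h" using assms(1) cyclotomic_group_inv by blast
    then show ?case using inv assms by (auto simp: mult_closedD)
  qed (use assms in \<open>auto simp: mult_closedD\<close>)
qed

lemma generate_eq_power_products:
  assumes "finite I" "f ` I \<subseteq> carrier (cyclotomic_group n)"
  shows "generate (cyclotomic_group n) (f ` I) = power_products I f"
proof
  have "f i \<noteq> 0" if "i \<in> I" for i
    using assms(2) that by (auto simp: cyclotomic_group_carrier)
  then show "generate (cyclotomic_group n) (f ` I) \<subseteq> power_products I f"
    using power_products_base[OF assms(1)]
    by (intro generate_subset_mult_closed power_products_mult_closed assms) auto
  show "power_products I f \<subseteq> generate (cyclotomic_group n) (f ` I)"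
    by (intro power_products_subset generate_mult_closed assms generate.incl) auto
qed

lemma generate_singleton:
  assumes "x \<in> carrier (cyclotomic_group n)"
  shows "generate (cyclotomic_group n) {x} = {x powi k |k. True}"
proof -
  have "generate (cyclotomic_group n) ((\<lambda>_. x) ` {()}) = power_products {()} (\<lambda>_. x)"
    by (rule generate_eq_power_products) (use assms in auto)
  also have "\<dots> = {x powi k |k. True}"
    unfolding power_products_def by (auto intro: exI[of _ "\<lambda>_. _"])
  finally show ?thesis by simp
qed

lemma mult_closed_subgroup:
  assumes "mult_closed S" "S \<subseteq> carrier (cyclotomic_group n)"
  shows "subgroup S (cyclotomic_group n)"
proof (rule subgroup.intro)
  fix x assume "x \<in> S"
  then have "inv\<^bsub>cyclotomic_group n\<^esub> x = inverse x"
    using assms(2) by (intro cyclotomic_group_inv) blast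
  then show "inv\<^bsub>cyclotomic_group n\<^esub> x \<in> S"
    using mult_closedD(3)[OF assms(1) \<open>x \<in> S\<close>] by simp
qed (use assms in \<open>auto simp: mult_closedD\<close>)

lemma finprod_cyclotomic_group:
  assumes "finite I" "\<And>i. i \<in> I \<Longrightarrow> f i \<in> carrier (cyclotomic_group n)"
  shows "finprod (cyclotomic_group n) f I = prod f I"
proof -
  interpret comm_group "cyclotomic_group n" by (rule cyclotomic_group_comm_group)
  show ?thesis using assms
  proof (induction I rule: finite_induct)
    case (insert i I)
    then have "finprod (cyclotomic_group n) f (insert i I)
        = f i \<otimes>\<^bsub>cyclotomic_group n\<^esub> finprod (cyclotomic_group n) f I"
      by (intro finprod_insert) auto
    then show ?case using insert by simp
  qed simp
qed

text \<open>The usual criterion for abelian groups: trivial intersection gives injectivity.\<close>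

lemma internal_direct_product2_cyclotomic:
  assumes A: "mult_closed A" "A \<subseteq> carrier (cyclotomic_group n)"
    and B: "mult_closed B" "B \<subseteq> carrier (cyclotomic_group n)"
    and AB: "A \<inter> B \<subseteq> {1}" and S: "S = {x * y |x y. x \<in> A \<and> y \<in> B}"
  shows "internal_direct_product2 (cyclotomic_group n) A B S"
proof -
  have SS: "S \<subseteq> carrier (cyclotomic_group n)"
    unfolding S using A(2) B(2) mult_closedD(2)[OF cyclotomic_group_carrier_mult_closed] by blast
  have nz: "x \<noteq> 0" if "x \<in> A \<or> x \<in> B" for x
    using that A B by (auto simp: cyclotomic_group_carrier)
  have inj: "a = a' \<and> b = b'" if "a \<in> A" "b \<in> B" "a' \<in> A" "b' \<in> B" "a * b = a' * b'" for a b a' b'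
  proof -
    have "a / a' = b' / b" using that nz[of a'] nz[of b] by (simp add: field_simps)
    moreover have "a / a' \<in> A" "b' / b \<in> B" using that A B by (auto intro: mult_closed_divide)
    ultimately have "a / a' = 1" "b' / b = 1" using AB by auto
    then show ?thesis using nz that by auto
  qed
  show ?thesis
    unfolding internal_direct_product2_def
  proof (intro conjI)
    show "subgroup A (cyclotomic_group n)" "subgroup B (cyclotomic_group n)"
      by (intro mult_closed_subgroup A B)+
    show "subgroup S (cyclotomic_group n)"
      using SS by (intro mult_closed_subgroup) (auto simp: S intro!: mult_closed_times A B)
    show "(\<lambda>(x, y). x \<otimes>\<^bsub>cyclotomic_group n\<^esub> y)
      \<in> iso (cyclotomic_group n\<lparr>carrier := A\<rparr> \<times>\<times> cyclotomic_group n\<lparr>carrier := B\<rparr>)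
            (cyclotomic_group n\<lparr>carrier := S\<rparr>)"
    proof (rule isoI)
      show "(\<lambda>(x, y). x \<otimes>\<^bsub>cyclotomic_group n\<^esub> y)
        \<in> hom (cyclotomic_group n\<lparr>carrier := A\<rparr> \<times>\<times> cyclotomic_group n\<lparr>carrier := B\<rparr>)
            (cyclotomic_group n\<lparr>carrier := S\<rparr>)"
        by (rule homI) (auto simp: S)
      show "bij_betw (\<lambda>(x, y). x \<otimes>\<^bsub>cyclotomic_group n\<^esub> y)
        (carrier (cyclotomic_group n\<lparr>carrier := A\<rparr> \<times>\<times> cyclotomic_group n\<lparr>carrier := B\<rparr>))
            (carrier (cyclotomic_group n\<lparr>carrier := S\<rparr>))"
        using inj by (auto simp: bij_betw_def inj_on_def S image_def)
    qed
  qed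
qed

section \<open>Cyclotomic integers and their units\<close>

lemma generate_ring_simps:
  assumes "x \<in> generate_ring complex_field H" "y \<in> generate_ring complex_field H"
  shows "x + y \<in> generate_ring complex_field H" "x * y \<in> generate_ring complex_field H"
  using generate_ring.eng_add[OF assms] generate_ring.eng_mult[OF assms]
  by (simp_all add: ring_of_type_algebra_def)

lemma complex_field_a_inv: "\<ominus>\<^bsub>complex_field\<^esub> x = - x"
proof -
  interpret C: field complex_field by (rule field_from_type_algebra)
  have "x \<in> carrier complex_field" by (simp add: ring_of_type_algebra_def)
  from C.r_neg[OF this] have "x + (\<ominus>\<^bsub>complex_field\<^esub> x) = 0"
    by (simp add: ring_of_type_algebra_def)
  then show ?thesis by (simp add: add_eq_0_iff)
qed

lemma generate_ring_1: "1 \<in> generate_ring complex_field H"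
  using generate_ring.one[of complex_field H] by (simp add: ring_of_type_algebra_def)

lemma generate_ring_minus:
  "x \<in> generate_ring complex_field H \<Longrightarrow> - x \<in> generate_ring complex_field H"
  using generate_ring.a_inv[of x complex_field H] by (simp add: complex_field_a_inv)

lemma generate_ring_power:
  "x \<in> generate_ring complex_field H \<Longrightarrow> x ^ k \<in> generate_ring complex_field H"
  by (induction k) (simp_all add: generate_ring_1 generate_ring_simps)

lemma generate_ring_prod:
  "(\<And>i. i \<in> I \<Longrightarrow> f i \<in> generate_ring complex_field H) \<Longrightarrow> prod f I \<in> generate_ring complex_field H"
  by (induction I rule: infinite_finite_induct) (simp_all add: generate_ring_1 generate_ring_simps)

lemma generate_ring_polynomial:
  assumes "x \<in> generate_ring complex_field {z}"
  shows "\<exists>f :: int poly. x = poly (map_poly of_int f) z"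
  using assms
proof induction
  case one
  show ?case by (intro exI[of _ 1]) (simp add: ring_of_type_algebra_def)
next
  case (incl h)
  then show ?case by (intro exI[of _ "[:0, 1:]"]) (simp add: map_poly_pCons)
next
  case (a_inv h)
  then obtain f :: "int poly" where "h = poly (map_poly of_int f) z" by blast
  then show ?case
    by (intro exI[of _ "[:-1:] * f"])
       (simp only: of_int_poly_mult poly_mult complex_field_a_inv, simp add: map_poly_pCons)
next
  case (eng_add h1 h2)
  then obtain f g :: "int poly" where "h1 = poly (map_poly of_int f) z" "h2 = poly (map_poly of_int g) z" by blast
  then show ?case
    by (intro exI[of _ "f + g"]) (simp add: of_int_poly_add ring_of_type_algebra_def)
next
  case (eng_mult h1 h2)
  then obtain f g :: "int poly" where "h1 = poly (map_poly of_int f) z" "h2 = poly (map_poly of_int g) z" by blast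
  then show ?case
    by (intro exI[of _ "f * g"]) (simp add: of_int_poly_mult ring_of_type_algebra_def)
qed

text \<open>If the product were \<open>1\<close>, then for \<open>x = f(z)\<close> the polynomial \<open>(1 - X)^k f - 1\<close> would vanish at
  \<open>z\<close>, although its value at \<open>1\<close> is \<open>-1\<close>, an odd number.\<close>

lemma one_minus_power_nonunit:
  assumes z: "z ^ (2 ^ r) = -1" and k: "k > 0" and x: "x \<in> generate_ring complex_field {z}"
  shows "(1 - z) ^ k * x \<noteq> 1"
proof
  assume *: "(1 - z) ^ k * x = 1"
  obtain f :: "int poly" where f: "x = poly (map_poly of_int f) z"
    using generate_ring_polynomial[OF x] by blast
  have pow: "poly (map_poly of_int ([:1, -1:] ^ k)) z = (1 - z) ^ k" for k
    by (induction k) (simp_all only: power_0 power_Suc of_int_poly_mult poly_mult,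
        simp_all add: map_poly_pCons)
  have "poly (map_poly of_int ([:1, -1:] ^ k * f + [:-1:])) z = 0"
    unfolding of_int_poly_add of_int_poly_mult poly_add poly_mult pow
    using * by (simp add: f map_poly_pCons)
  then have "even (poly ([:1, -1:] ^ k * f + [:-1:]) (1::int))"
    using z by (rule even_at_1_if_root[rotated])
  then show False using k by simp
qed

lemma Units_cyclotomic_integers:
  "x \<in> Units (cyclotomic_integers n) \<longleftrightarrow>
     x \<in> generate_ring complex_field {root2n n} \<and>
     (\<exists>y \<in> generate_ring complex_field {root2n n}. x * y = 1)"
  by (auto simp: Units_def cyclotomic_integers_def ring_of_type_algebra_def mult.commute)

lemma Units_cyclotomic_integers_mult_closed: "mult_closed (Units (cyclotomic_integers n))"
proof (rule mult_closedI)
  show "1 \<in> Units (cyclotomic_integers n)"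
    unfolding Units_cyclotomic_integers using generate_ring_1 by (auto intro!: bexI[of _ 1])
  fix x assume x: "x \<in> Units (cyclotomic_integers n)"
  then obtain x' where x': "x \<in> generate_ring complex_field {root2n n}"
    "x' \<in> generate_ring complex_field {root2n n}" "x * x' = 1"
    unfolding Units_cyclotomic_integers by blast
  then have "inverse x = x'" by (metis inverse_unique)
  then show "inverse x \<in> Units (cyclotomic_integers n)"
    unfolding Units_cyclotomic_integers using x' by (auto simp: mult.commute)
  fix y assume "y \<in> Units (cyclotomic_integers n)"
  then obtain y' where y': "y \<in> generate_ring complex_field {root2n n}"
    "y' \<in> generate_ring complex_field {root2n n}" "y * y' = 1"
    unfolding Units_cyclotomic_integers by blast
  have "(x * y) * (x' * y') = (x * x') * (y * y')" by (simp add: ac_simps)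
  also have "\<dots> = 1" using x' y' by simp
  finally have "(x * y) * (x' * y') = 1" .
  then show "x * y \<in> Units (cyclotomic_integers n)"
    unfolding Units_cyclotomic_integers using x' y' by (meson generate_ring_simps)
qed

lemma root2n_Units: "root2n n \<in> Units (cyclotomic_integers n)"
proof -
  have "root2n n \<in> generate_ring complex_field {root2n n}" by (rule generate_ring.incl) simp
  moreover have "root2n n * root2n n ^ (2 ^ n - 1) = 1"
    using root2n_power_full[of n] by (simp flip: power_Suc)
  ultimately show ?thesis unfolding Units_cyclotomic_integers using generate_ring_power by blast
qed

lemma circular_d_integer: "circular_d n j \<in> generate_ring complex_field {root2n n}"
proof -
  have "root2n n powi k \<in> generate_ring complex_field {root2n n}" for k
    using mult_closed_powi[OF Units_cyclotomic_integers_mult_closed root2n_Units, of n k]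
    unfolding Units_cyclotomic_integers by blast
  then show ?thesis
    unfolding circular_d_def by (intro generate_ring_simps generate_ring_1)
qed

text \<open>The norm of \<open>d_1\<close> from the real subfield to the rational numbers. In the step from \<open>m\<close> to
  \<open>m + 1\<close>, pairing \<open>j\<close> with \<open>2^(m + 2) - j\<close>, which up to sign is
  \<open>j + 2^(m + 2)\<close> modulo \<open>2^(m + 3)\<close>, reduces it to the product one level below by
  \<open>circular_d_norm\<close>.\<close>

lemma circular_d_prod: "(\<Prod>l<2 ^ m. circular_d (m + 2) (2 * int l + 1)) \<in> {1, -1}"
proof (induction m)
  case 0
  define z where "z = root2n (Suc (Suc 0))"
  have "z * z = -1"
    using root2n_power_half[of "Suc 0"] by (simp add: z_def power2_eq_square)
  then have "inverse z = - z" by (metis inverse_unique minus_minus mult_minus_right)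
  then show ?case by (simp add: circular_d_def power_int_minus flip: z_def)
next
  case (Suc m)
  define F where "F l = circular_d (Suc (m + 2)) (2 * int l + 1)" for l
  have "F (2 ^ m + (2 ^ m - Suc l)) = circular_d (Suc (m + 2)) ((2 * int l + 1) + 2 ^ (m + 2))"
    if "l < 2 ^ m" for l
    unfolding F_def
  proof (rule circular_d_cong)
    have "int (2 ^ m - Suc l) = 2 ^ m - 1 - int l" using that by (simp add: of_nat_diff)
    then have "2 * int (2 ^ m + (2 ^ m - Suc l)) + 1 + ((2 * int l + 1) + 2 ^ (m + 2)) = 2 ^ Suc (m + 2)"
      by simp
    then show "2 ^ Suc (m + 2) dvd 2 * int (2 ^ m + (2 ^ m - Suc l)) + 1 - ((2 * int l + 1) + 2 ^ (m + 2))
      \<or> 2 ^ Suc (m + 2) dvd 2 * int (2 ^ m + (2 ^ m - Suc l)) + 1 + ((2 * int l + 1) + 2 ^ (m + 2))"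
      by (metis dvd_refl)
  qed
  then have pair: "F l * F (2 ^ m + (2 ^ m - Suc l)) = - circular_d (m + 2) (2 * int l + 1)"
    if "l < 2 ^ m" for l
    using that circular_d_norm[of "m + 2" "2 * int l + 1"] by (simp add: F_def)
  have "(\<Prod>l<a + b. F l) = (\<Prod>l<a. F l) * (\<Prod>l<b. F (a + l))" for a b
    by (induction b) (simp_all add: mult.assoc)
  from this[of "2 ^ m" "2 ^ m"]
  have "(\<Prod>l<2 ^ Suc m. F l) = (\<Prod>l<2 ^ m. F l) * (\<Prod>l<2 ^ m. F (2 ^ m + l))"
    unfolding power_Suc mult_2 .
  also have "(\<Prod>l<2 ^ m. F (2 ^ m + l)) = (\<Prod>l<2 ^ m. F (2 ^ m + (2 ^ m - Suc l)))"
    by (rule prod.nat_diff_reindex[symmetric])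
  also have "(\<Prod>l<2 ^ m. F l) * (\<Prod>l<2 ^ m. F (2 ^ m + (2 ^ m - Suc l)))
      = (\<Prod>l<2 ^ m. -1 * circular_d (m + 2) (2 * int l + 1))"
    unfolding prod.distrib[symmetric] by (intro prod.cong) (simp_all only: lessThan_iff mult_minus1 pair)
  also have "\<dots> = (-1) ^ (2 ^ m) * (\<Prod>l<2 ^ m. circular_d (m + 2) (2 * int l + 1))"
    unfolding prod.distrib by simp
  finally show ?case using Suc.IH by (cases "even (2 ^ m :: nat)") (auto simp: F_def)
qed

text \<open>The inverse is, up to sign, the product of the other factors in \<open>circular_d_prod\<close>.\<close>

lemma circular_d_Units:
  assumes "odd j"
  shows "circular_d (m + 2) j \<in> Units (cyclotomic_integers (m + 2))"
proof -
  obtain l where l: "l < 2 ^ m" "2 ^ (m + 2) dvd j - (2 * int l + 1) \<or> 2 ^ (m + 2) dvd j + (2 * int l + 1)"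
    using odd_representative[OF assms] by blast
  define y where "y = (\<Prod>i\<in>{..<2 ^ m} - {l}. circular_d (m + 2) (2 * int i + 1))"
  have "y \<in> generate_ring complex_field {root2n (m + 2)}"
    unfolding y_def by (intro generate_ring_prod circular_d_integer)
  moreover have "circular_d (m + 2) (2 * int l + 1) * y \<in> {1, -1}"
    unfolding y_def using circular_d_prod[of m] l(1)
    by (simp add: prod.remove[of "{..<2 ^ m}" l])
  ultimately have "\<exists>y \<in> generate_ring complex_field {root2n (m + 2)}.
       circular_d (m + 2) (2 * int l + 1) * y = 1"
    by (auto intro: generate_ring_minus bexI[of _ "-y"])
  then show ?thesis
    unfolding Units_cyclotomic_integers circular_d_cong[OF l(2)] using circular_d_integer by blast
qed

lemma one_minus_root2n_generator:
  assumes "\<not> 2 ^ n dvd j"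
  shows "1 - root2n n powi j \<in> {1 - root2n n ^ k |k. k \<in> {1..2 ^ n - 1}}"
proof -
  define r where "r = j mod 2 ^ n"
  have r: "0 < r" "r < 2 ^ n" using assms by (simp_all add: r_def dvd_eq_mod_eq_0 order.not_eq_order_implies_strict)
  have "root2n n powi j = root2n n powi r" by (rule root2n_powi_cong) (simp add: r_def)
  also have "\<dots> = root2n n ^ nat r" using r by (simp add: power_int_def)
  finally show ?thesis using r
    by (intro CollectI exI[of _ "nat r"]) (auto simp: nat_less_iff nat_le_iff)
qed

section \<open>Circular numbers and the group \<open>D\<close>\<close>

lemma power2_times_odd:
  "k > 0 \<Longrightarrow> \<exists>v j. k = 2 ^ v * j \<and> odd (j :: nat)"
proof (induction k rule: less_induct)
  case (less k)
  show ?case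
  proof (cases "even k")
    case True
    then obtain i where i: "k = 2 * i" by (elim evenE)
    then obtain v j where "i = 2 ^ v * j" "odd j" using less by (metis less_add_same_cancel1 mult_2 nat_0_less_mult_iff)
    then show ?thesis using i by (intro exI[of _ "Suc v"] exI[of _ j]) simp
  next
    case False
    then show ?thesis by (intro exI[of _ 0] exI[of _ k]) simp
  qed
qed

lemma root2n_powi_power2: "root2n (v + n) powi (2 ^ v * j) = root2n n powi j"
  by (induction v) (simp_all add: mult.assoc root2n_powi_double)

lemma one_minus_root2n_nonzero:
  assumes "k \<in> {1..2 ^ n - 1}"
  shows "1 - root2n n ^ k \<noteq> 0"
proof -
  obtain v j where k: "k = 2 ^ v * j" "odd j" using power2_times_odd[of k] assms by auto
  have "j > 0" using k(2) by (cases j) auto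
  then have "2 ^ v \<le> k" by (simp add: k)
  also have "k < 2 ^ n"
  proof -
    have "0 < (2::nat) ^ n" by simp
    moreover have "k \<le> 2 ^ n - 1" using assms by simp
    ultimately show ?thesis by linarith
  qed
  finally have "v < n" by simp
  then obtain n' where n: "n = v + Suc n'" by (metis add_Suc_right less_iff_Suc_add)
  have "root2n n ^ k = root2n n powi (2 ^ v * int j)"
    by (simp add: k flip: power_int_of_nat)
  also have "\<dots> = root2n (Suc n') powi (int j)" unfolding n by (rule root2n_powi_power2)
  also have "\<dots> \<noteq> 1" using k(2) by (intro powi_odd_neq_1) simp
  finally show ?thesis by simp
qed

lemma root2n_carrier: "root2n n \<in> carrier (cyclotomic_group n)"
  unfolding cyclotomic_group_carrier by (auto intro: generate_field.incl)

lemma one_minus_generators_carrier: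
  "{1 - root2n n ^ k |k. k \<in> {1..2 ^ n - 1}} \<subseteq> carrier (cyclotomic_group n)"
proof clarify
  fix k :: nat assume k: "k \<in> {1..2 ^ n - 1}"
  have "root2n n ^ k \<in> carrier (cyclotomic_group n)"
    using mult_closed_powi[OF cyclotomic_group_carrier_mult_closed root2n_carrier, of n "int k"] by simp
  then have "root2n n ^ k \<in> generate_field complex_field {root2n n}"
    unfolding cyclotomic_group_carrier by blast
  then have "1 + - (root2n n ^ k) \<in> generate_field complex_field {root2n n}"
    using generate_field.one[of complex_field "{root2n n}"]
      generate_field.a_inv[of "root2n n ^ k" complex_field "{root2n n}", unfolded complex_field_a_inv]
      generate_field.eng_add[of 1 complex_field "{root2n n}" "- (root2n n ^ k)"]
    by (simp add: ring_of_type_algebra_def)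
  then show "1 - root2n n ^ k \<in> carrier (cyclotomic_group n)"
    unfolding cyclotomic_group_carrier using one_minus_root2n_nonzero[OF k] by simp
qed

lemma circular_numbers_mult_closed: "mult_closed (circular_numbers n)"
  unfolding circular_numbers_def by (rule generate_mult_closed[OF one_minus_generators_carrier])

lemma circular_numbers_carrier: "circular_numbers n \<subseteq> carrier (cyclotomic_group n)"
  unfolding circular_numbers_def
  by (rule generate_subset_mult_closed[OF one_minus_generators_carrier one_minus_generators_carrier
        cyclotomic_group_carrier_mult_closed])

lemma one_minus_circular_number:
  "\<not> 2 ^ n dvd j \<Longrightarrow> 1 - root2n n powi j \<in> circular_numbers n"
  unfolding circular_numbers_def by (rule generate.incl) (rule one_minus_root2n_generator)

lemma odd_not_power2_dvd: "odd (j::int) \<Longrightarrow> \<not> 2 ^ Suc n dvd j"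
  by (meson dvd_power dvd_trans zero_less_Suc)

text \<open>The generators yield \<open>(1 - \<alpha>) / (1 - 1/\<alpha>) = -\<alpha>\<close>. Since \<open>\<alpha>^(2^(m + 1)) = -1\<close>, the power of
  \<open>-\<alpha>\<close> with the odd exponent \<open>1 + 2^(m + 1)\<close> is \<open>\<alpha>\<close>.\<close>

lemma root2n_circular_number: "root2n (m + 2) \<in> circular_numbers (m + 2)"
proof -
  define z where "z = root2n (m + 2)"
  have n: "m + 2 = Suc (m + 1)" by simp
  have z1: "z powi 1 \<noteq> 1" "z powi (-1) \<noteq> 1" "z \<noteq> 0"
    unfolding z_def n by (intro powi_odd_neq_1; simp)+ (rule root2n_nonzero)
  have "\<not> 2 ^ (m + 2) dvd (1::int)" "\<not> 2 ^ (m + 2) dvd (-1::int)"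
    unfolding n by (rule odd_not_power2_dvd; simp)+
  then have "(1 - z powi 1) / (1 - z powi (-1)) \<in> circular_numbers (m + 2)"
    unfolding z_def by (intro mult_closed_divide circular_numbers_mult_closed one_minus_circular_number)
  also have "(1 - z powi 1) / (1 - z powi (-1)) = - z"
    using z1 by (simp add: power_int_minus field_simps)
  finally have "(- z) powi (1 + 2 ^ (m + 1)) \<in> circular_numbers (m + 2)"
    by (rule mult_closed_powi[OF circular_numbers_mult_closed])
  also have "(- z) powi (1 + 2 ^ (m + 1)) = - z * (- z) powi (2 ^ (m + 1))"
    using z1 by (simp add: power_int_add)
  also have "(- z) powi (2 ^ (m + 1)) = z powi (2 ^ (m + 1))"
    by (rule power_int_minus_left_even) simp
  also have "\<dots> = -1" unfolding z_def n by (rule root2n_powi_half)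
  finally show ?thesis by (simp add: z_def)
qed

lemma circular_d_circular_number:
  assumes "odd j"
  shows "circular_d (m + 2) j \<in> circular_numbers (m + 2)"
proof -
  have n: "m + 2 = Suc (m + 1)" by simp
  define z where "z = root2n (m + 2)"
  have "z powi j \<noteq> 1" unfolding z_def n by (rule powi_odd_neq_1[OF assms])
  then have nz: "z powi j * (1 - z powi j) \<noteq> 0" by (simp add: z_def)
  have "circular_d (m + 2) j = (1 - z powi (3 * j)) / (z powi j * (1 - z powi j))"
    using circular_d_quotient[of "m + 2" j, folded z_def] by (simp only: nonzero_eq_divide_eq[OF nz])
  moreover have "1 - z powi k \<in> circular_numbers (m + 2)" if "odd k" for k
    unfolding z_def n by (rule one_minus_circular_number[OF odd_not_power2_dvd[OF that]])
  moreover have "odd (3 * j)" using assms by simp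
  moreover have "z powi j \<in> circular_numbers (m + 2)"
    unfolding z_def by (intro mult_closed_powi circular_numbers_mult_closed root2n_circular_number)
  ultimately show ?thesis
    using mult_closed_divide mult_closedD(2) circular_numbers_mult_closed assms by metis
qed

lemma circular_d_carrier: "odd j \<Longrightarrow> circular_d (m + 2) j \<in> carrier (cyclotomic_group (m + 2))"
  using circular_d_circular_number circular_numbers_carrier by blast

lemma d_indices_eq: "d_indices (m + 2) = {..<2 ^ m - 1}"
  by (auto simp: d_indices_def)

lemma d_group_eq:
  "d_group (m + 2) = power_products {..<2 ^ m - 1} (\<lambda>l. circular_d (m + 2) (2 * int l + 1))"
proof -
  have "d_group (m + 2) =
      generate (cyclotomic_group (m + 2)) ((\<lambda>l. circular_d (m + 2) (2 * int l + 1)) ` {..<2 ^ m - 1})"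
    unfolding d_group_def d_indices_eq Setcompr_eq_image ..
  also have "\<dots> = power_products {..<2 ^ m - 1} (\<lambda>l. circular_d (m + 2) (2 * int l + 1))"
    by (rule generate_eq_power_products, simp, rule image_subsetI, rule circular_d_carrier, simp)
  finally show ?thesis .
qed

lemma d_group_mult_closed: "mult_closed (d_group (m + 2))"
  unfolding d_group_eq using circular_d_nonzero[of _ "m + 1"] by (intro power_products_mult_closed) simp

lemma d_group_carrier: "d_group (m + 2) \<subseteq> carrier (cyclotomic_group (m + 2))"
  unfolding d_group_eq
  by (intro power_products_subset cyclotomic_group_carrier_mult_closed circular_d_carrier) simp

lemma d_group_real: "d_group (m + 2) \<subseteq> \<real>"
  unfolding d_group_eq by (intro power_products_subset mult_closed_Reals circular_d_real)

lemma d_group_trivial_torsion: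
  assumes "x \<in> d_group (m + 2)" "x \<in> {1, -1}"
  shows "x = 1"
proof -
  obtain a where a: "x = (\<Prod>l<2 ^ m - 1. circular_d (m + 2) (2 * int l + 1) powi a l)"
    using assms(1) unfolding d_group_eq power_products_def by blast
  have "a l = 0" if "l < 2 ^ m - 1" for l
    by (rule circular_d_independent[OF _ that]) (use assms(2) a in simp)
  then show ?thesis unfolding a by (intro prod.neutral) simp
qed

lemma root2n_powi_real:
  assumes "root2n n powi k \<in> \<real>"
  shows "root2n n powi k \<in> {1, -1}"
proof -
  obtain r where r: "root2n n powi k = of_real r" using assms by (rule Reals_cases)
  have "norm (root2n n powi k) = 1" by (simp add: norm_power_int)
  then have "\<bar>r\<bar> = 1" unfolding r by simp
  then show ?thesis unfolding r by (auto simp: abs_if split: if_splits)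
qed

lemma minus_one_root2n_powi: "\<exists>k. -1 = root2n (m + 2) powi k"
  using root2n_powi_half[of "m + 1"] by (intro exI[of _ "2 ^ (m + 1)"]) simp

lemma odd_power3_representative:
  assumes "odd (j::int)"
  shows "\<exists>i. 2 ^ (m + 2) dvd j - 3 ^ i \<or> 2 ^ (m + 2) dvd j + 3 ^ i"
proof -
  obtain \<pi> where \<pi>: "bij_betw \<pi> {..<2 ^ m} {..<2 ^ m}"
    "\<And>i. 2 ^ (m + 2) dvd (3::int) ^ i - (2 * int (\<pi> i) + 1)
       \<or> 2 ^ (m + 2) dvd (3::int) ^ i + (2 * int (\<pi> i) + 1)"
    using power3_reindexing[of m] by blast
  obtain l where l: "l < 2 ^ m" "2 ^ (m + 2) dvd j - (2 * int l + 1) \<or> 2 ^ (m + 2) dvd j + (2 * int l + 1)"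
    using odd_representative[OF assms] by blast
  obtain i where i: "\<pi> i = l" using \<pi>(1) l(1) by (metis bij_betw_def imageE lessThan_iff)
  define c where "c = 2 * int l + 1"
  have "2 ^ (m + 2) dvd (3::int) ^ i - c \<or> 2 ^ (m + 2) dvd (3::int) ^ i + c"
    using \<pi>(2)[of i] unfolding i c_def .
  moreover have "2 ^ (m + 2) dvd j - c \<or> 2 ^ (m + 2) dvd j + c" using l(2) unfolding c_def .
  moreover have
    "(j - c) - (3 ^ i - c) = j - 3 ^ i" "(j - c) + (3 ^ i + c) = j + 3 ^ i"
    "(j + c) - (3 ^ i + c) = j - 3 ^ i" "(j + c) + (3 ^ i - c) = j + 3 ^ i" by simp_all
  ultimately show ?thesis by (metis dvd_add dvd_diff)
qed

section \<open>Circular units\<close>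

text \<open>The product of \<open>\<langle>\<alpha>\<rangle>\<close> and \<open>D\<close>, which \<open>circular_units_eq\<close> identifies with the circular units at
  level \<open>m + 2\<close>.\<close>

definition unit_group :: "nat \<Rightarrow> complex set" where
  "unit_group m = {x * y |x y. x \<in> {root2n (m + 2) powi k |k. True} \<and> y \<in> d_group (m + 2)}"

lemma root2n_powi_mult_closed: "mult_closed {root2n n powi k |k. True}"
proof (rule mult_closedI)
  show "1 \<in> {root2n n powi k |k. True}" by (auto intro!: exI[of _ 0])
next
  fix x y assume "x \<in> {root2n n powi k |k. True}" "y \<in> {root2n n powi k |k. True}"
  then obtain k l where "x = root2n n powi k" "y = root2n n powi l" by blast
  then show "x * y \<in> {root2n n powi k |k. True}"
    by (intro CollectI exI[of _ "k + l"]) (simp add: power_int_add)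
next
  fix x assume "x \<in> {root2n n powi k |k. True}"
  then obtain k where "x = root2n n powi k" by blast
  then show "inverse x \<in> {root2n n powi k |k. True}"
    by (intro CollectI exI[of _ "-k"]) (simp add: power_int_minus)
qed

lemma unit_group_mult_closed: "mult_closed (unit_group m)"
  unfolding unit_group_def by (intro mult_closed_times root2n_powi_mult_closed d_group_mult_closed)

lemma root2n_powi_unit_group: "root2n (m + 2) powi k \<in> unit_group m"
  unfolding unit_group_def using mult_closedD(1)[OF d_group_mult_closed] 
  by (intro CollectI exI[of _ "root2n (m + 2) powi k"] exI[of _ 1]) auto

lemma minus_unit_group: "x \<in> unit_group m \<Longrightarrow> - x \<in> unit_group m"
  using minus_one_root2n_powi[of m] root2n_powi_unit_group[of m] mult_closedD(2)[OF unit_group_mult_closed]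
  by (metis mult_minus1)

lemma d_group_unit_group: "x \<in> d_group (m + 2) \<Longrightarrow> x \<in> unit_group m"
  unfolding unit_group_def by (intro CollectI exI[of _ 1] exI[of _ x]) (auto intro!: exI[of _ 0])

text \<open>Up to the sign of the index and multiples of \<open>2^(m + 2)\<close>, only \<open>d_(2^(m + 1) - 1)\<close> is not among the generators of \<open>D\<close>; it is
  \<open>\<plusminus> 1\<close> divided by the product of the generators, and \<open>-1\<close> is a power of \<open>\<alpha>\<close>.\<close>

lemma circular_d_unit_group:
  assumes "odd j"
  shows "circular_d (m + 2) j \<in> unit_group m"
proof -
  let ?d = "\<lambda>l. circular_d (m + 2) (2 * int l + 1)"
  obtain l where l: "l < 2 ^ m" "2 ^ (m + 2) dvd j - (2 * int l + 1) \<or> 2 ^ (m + 2) dvd j + (2 * int l + 1)"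
    using odd_representative[OF assms] by blast
  have base: "?d i \<in> unit_group m" if "i < 2 ^ m - 1" for i
    using that by (intro d_group_unit_group) (simp only: d_group_eq, rule power_products_base, auto)
  show ?thesis
  proof (cases "l = 2 ^ m - 1")
    case False
    then show ?thesis unfolding circular_d_cong[OF l(2)] using l(1) by (intro base) simp
  next
    case True
    define y where "y = (\<Prod>i<2 ^ m - 1. ?d i)"
    have y: "inverse y \<in> unit_group m"
      unfolding y_def by (intro mult_closedD(3)[OF unit_group_mult_closed] mult_closed_prod unit_group_mult_closed base) simp
    have "{..<2 ^ m} = insert l {..<2 ^ m - 1}" using True l(1) by auto
    then have "y * ?d l \<in> {1, -1}" using circular_d_prod[of m] True by (simp add: y_def mult.commute)
    then have "y * ?d l = 1 \<or> y * (- ?d l) = 1" by auto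
    then have "inverse y = ?d l \<or> inverse y = - ?d l" using inverse_unique by blast
    then show ?thesis
      unfolding circular_d_cong[OF l(2)] using y minus_unit_group[OF y] by (metis minus_minus)
  qed
qed

text \<open>For odd exponents (\<open>v = 0\<close>) one walks from \<open>1\<close> to \<open>3^i\<close>, each step contributing a factor
  \<open>d \<alpha>^(3^i)\<close>, and changes sign by \<open>1 - 1/x = - (1/x) (1 - x)\<close>. An even exponent \<open>2k\<close> is split as
  \<open>1 - \<alpha>^(2k) = (1 - \<alpha>^k) (1 - \<alpha>^(k + 2^(m + 1)))\<close>, where both exponents on the right have one
  factor \<open>2\<close> less.\<close>

lemma one_minus_power_factorisation:
  assumes "v < m + 2" "odd j"
  shows "\<exists>w\<in>unit_group m. \<exists>e. 1 - root2n (m + 2) powi (2 ^ v * j) = w * (1 - root2n (m + 2)) powi e"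
  using assms
proof (induction v arbitrary: j)
  case 0
  define z where "z = root2n (m + 2)"
  have pow3: "\<exists>w\<in>unit_group m. 1 - z powi (3 ^ i) = w * (1 - z)" for i
  proof (induction i)
    case 0
    show ?case using mult_closedD(1)[OF unit_group_mult_closed] by (intro bexI[of _ 1]) simp_all
  next
    case (Suc i)
    then obtain w where w: "w \<in> unit_group m" "1 - z powi (3 ^ i) = w * (1 - z)" by blast
    have "1 - z powi (3 ^ Suc i) = circular_d (m + 2) (3 ^ i) * (z powi (3 ^ i) * (w * (1 - z)))"
      unfolding z_def power_Suc circular_d_quotient[symmetric] w(2)[unfolded z_def] ..
    moreover have "circular_d (m + 2) (3 ^ i) * (z powi (3 ^ i) * w) \<in> unit_group m"
      unfolding z_def
      by (intro mult_closedD(2)[OF unit_group_mult_closed] circular_d_unit_group root2n_powi_unit_group w) simp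
    ultimately show ?case by (metis mult.assoc)
  qed
  obtain i where "2 ^ (m + 2) dvd j - 3 ^ i \<or> 2 ^ (m + 2) dvd j - (- (3 ^ i))"
    using odd_power3_representative[OF 0(2)] by auto
  then consider "z powi j = z powi (3 ^ i)" | "z powi j = z powi (- (3 ^ i))"
    unfolding z_def using root2n_powi_cong by blast
  then have "\<exists>w\<in>unit_group m. 1 - z powi j = w * (1 - z)"
  proof cases
    case 1
    then show ?thesis using pow3 by simp
  next
    case 2
    obtain w where w: "w \<in> unit_group m" "1 - z powi (3 ^ i) = w * (1 - z)" using pow3 by blast
    have "z \<noteq> 0" by (simp add: z_def)
    then have "1 - z powi (- (3 ^ i)) = - (z powi (- (3 ^ i)) * (1 - z powi (3 ^ i)))"
      by (simp add: power_int_minus field_simps)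
    also have "\<dots> = - (z powi (- (3 ^ i)) * w) * (1 - z)" unfolding w(2) by simp
    finally have "1 - z powi j = - (z powi (- (3 ^ i)) * w) * (1 - z)" unfolding 2 .
    moreover have "- (z powi (- (3 ^ i)) * w) \<in> unit_group m"
      unfolding z_def
      by (intro minus_unit_group mult_closedD(2)[OF unit_group_mult_closed] root2n_powi_unit_group w)
    ultimately show ?thesis by blast
  qed
  then show ?case unfolding z_def by (auto intro!: exI[of _ 1])
next
  case (Suc v)
  define z where "z = root2n (m + 2)"
  have z: "z \<noteq> 0" "1 - z \<noteq> 0"
    using powi_odd_neq_1[of 1 "m + 1"] by (simp_all add: z_def)
  obtain t where t: "m + 1 = v + Suc t" using Suc.prems(1) by (metis Suc_eq_plus1 add_2_eq_Suc' add_Suc_right less_imp_Suc_add not_less_eq)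
  define k where "k = 2 ^ v * j"
  have k': "k + 2 ^ (m + 1) = 2 ^ v * (j + 2 ^ Suc t)" unfolding t power_add by (simp add: k_def algebra_simps)
  obtain w e where w: "w \<in> unit_group m" "1 - z powi k = w * (1 - z) powi e"
    using Suc.IH[of j] Suc.prems by (auto simp: z_def k_def)
  obtain w' e' where w': "w' \<in> unit_group m" "1 - z powi (k + 2 ^ (m + 1)) = w' * (1 - z) powi e'"
    using Suc.IH[of "j + 2 ^ Suc t"] Suc.prems unfolding k' by (auto simp: z_def)
  have half: "z powi (2 ^ (m + 1)) = -1" using root2n_powi_half[of "m + 1"] by (simp add: z_def)
  have "2 ^ Suc v * j = k + k" by (simp add: k_def)
  then have "1 - z powi (2 ^ Suc v * j) = 1 - z powi (k + k)" by (simp only:)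
  also have "\<dots> = (1 - z powi k) * (1 + z powi k)" 
    unfolding power_int_add[OF disjI1[OF z(1)]] by (simp add: algebra_simps)
  also have "1 + z powi k = 1 - z powi (k + 2 ^ (m + 1))" unfolding power_int_add[OF disjI1[OF z(1)]] half by simp
  also have "(1 - z powi k) * \<dots> = (w * w') * (1 - z) powi (e + e')"
    unfolding w(2) w'(2) power_int_add[OF disjI1[OF z(2)]] by (simp only: ac_simps)
  finally show ?case unfolding z_def[symmetric]
    using mult_closedD(2)[OF unit_group_mult_closed w(1) w'(1)] by blast
qed

lemma circular_units_mult_closed: "mult_closed (circular_units n)"
  unfolding circular_units_def
  by (intro mult_closed_Int circular_numbers_mult_closed Units_cyclotomic_integers_mult_closed)

lemma circular_numbers_factorisation:
  assumes "x \<in> circular_numbers (m + 2)"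
  shows "\<exists>w\<in>unit_group m. \<exists>e. x = w * (1 - root2n (m + 2)) powi e"
proof -
  let ?u = "1 - root2n (m + 2)"
  have u: "?u \<noteq> 0" using powi_odd_neq_1[of 1 "m + 1"] by simp
  define V where "V = {w * y |w y. w \<in> unit_group m \<and> y \<in> power_products {()} (\<lambda>_. ?u)}"
  have "mult_closed V"
    unfolding V_def by (intro mult_closed_times unit_group_mult_closed power_products_mult_closed u)
  moreover have "{1 - root2n (m + 2) ^ k |k. k \<in> {1..2 ^ (m + 2) - 1}} \<subseteq> V"
  proof clarify
    fix k :: nat assume k: "k \<in> {1..2 ^ (m + 2) - 1}"
    obtain v j where vj: "k = 2 ^ v * j" "odd j" using power2_times_odd[of k] k by auto
    have "j > 0" using vj(2) by (cases j) auto
    then have "2 ^ v \<le> k" by (simp add: vj)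
    also have "k < 2 ^ (m + 2)"
    proof -
      have "0 < (2::nat) ^ (m + 2)" by simp
      moreover have "k \<le> 2 ^ (m + 2) - 1" using k by simp
      ultimately show ?thesis by linarith
    qed
    finally have "v < m + 2" by (rule power_less_imp_less_exp[rotated]) simp
    then obtain w e where w: "w \<in> unit_group m"
      "1 - root2n (m + 2) powi (2 ^ v * int j) = w * ?u powi e"
      using one_minus_power_factorisation[of v m "int j"] vj(2) by auto
    have "root2n (m + 2) powi (2 ^ v * int j) = root2n (m + 2) ^ k"
      unfolding vj(1) by (simp flip: power_int_of_nat)
    moreover have "?u powi e \<in> power_products {()} (\<lambda>_. ?u)"
      unfolding power_products_def by (auto intro!: exI[of _ "\<lambda>_. e"])
    ultimately show "1 - root2n (m + 2) ^ k \<in> V" using w unfolding V_def by auto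
  qed
  ultimately have "circular_numbers (m + 2) \<subseteq> V"
    unfolding circular_numbers_def by (intro generate_subset_mult_closed one_minus_generators_carrier)
  then have "x \<in> V" using assms by blast
  then show ?thesis unfolding V_def power_products_def by auto
qed

lemma unit_group_subset_circular_units: "unit_group m \<subseteq> circular_units (m + 2)"
proof -
  have "d_group (m + 2) \<subseteq> circular_units (m + 2)"
    unfolding d_group_eq circular_units_def
    by (intro power_products_subset mult_closed_Int circular_numbers_mult_closed
        Units_cyclotomic_integers_mult_closed IntI circular_d_circular_number circular_d_Units) simp_all
  moreover have "root2n (m + 2) powi k \<in> circular_units (m + 2)" for k
    unfolding circular_units_def
    by (intro mult_closed_powi mult_closed_Int circular_numbers_mult_closed
        Units_cyclotomic_integers_mult_closed IntI root2n_circular_number root2n_Units)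
  ultimately show ?thesis
    unfolding unit_group_def using mult_closedD(2)[OF circular_units_mult_closed] by blast
qed

lemma one_minus_powi_unit:
  assumes "(1 - root2n (Suc n)) powi e \<in> Units (cyclotomic_integers (Suc n))"
  shows "e = 0"
proof (rule ccontr)
  assume e: "e \<noteq> 0"
  let ?u = "1 - root2n (Suc n)"
  have "?u powi (- e) \<in> Units (cyclotomic_integers (Suc n))"
    using mult_closedD(3)[OF Units_cyclotomic_integers_mult_closed assms] by (simp add: power_int_minus)
  then have "?u powi \<bar>e\<bar> \<in> Units (cyclotomic_integers (Suc n))"
    using assms by (auto simp: abs_if)
  moreover have "?u powi \<bar>e\<bar> = ?u ^ nat \<bar>e\<bar>" by (simp add: power_int_def)
  ultimately obtain x where "x \<in> generate_ring complex_field {root2n (Suc n)}" "?u ^ nat \<bar>e\<bar> * x = 1"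
    unfolding Units_cyclotomic_integers by auto
  moreover have "nat \<bar>e\<bar> > 0" using e by simp
  ultimately show False using one_minus_power_nonunit[OF root2n_power_half[of n]] by blast
qed

text \<open>A circular unit is \<open>w (1 - \<alpha>)^e\<close> with \<open>w\<close> a circular unit, so \<open>(1 - \<alpha>)^e\<close> is a unit and
  \<open>e = 0\<close>.\<close>

theorem circular_units_eq: "circular_units (m + 2) = unit_group m"
proof
  show "unit_group m \<subseteq> circular_units (m + 2)" by (rule unit_group_subset_circular_units)
  show "circular_units (m + 2) \<subseteq> unit_group m"
  proof
    fix x assume x: "x \<in> circular_units (m + 2)"
    then obtain w e where w: "w \<in> unit_group m" "x = w * (1 - root2n (m + 2)) powi e"
      using circular_numbers_factorisation unfolding circular_units_def by blast
    have w': "w \<in> circular_units (m + 2)" using w(1) unit_group_subset_circular_units by blast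
    have "w \<noteq> 0"
      using w' circular_numbers_carrier[of "m + 2"] unfolding circular_units_def by auto
    then have "(1 - root2n (m + 2)) powi e = x / w" using w(2) by simp
    also have "\<dots> \<in> circular_units (m + 2)" by (rule mult_closed_divide[OF circular_units_mult_closed x w'])
    finally have "e = 0" using one_minus_powi_unit[of "m + 1" e] by (simp add: circular_units_def)
    then show "x \<in> unit_group m" using w by simp
  qed
qed

section \<open>The direct product decompositions\<close>

text \<open>Surjectivity is the description of \<open>D\<close> by exponents; injectivity is independence applied to the
  differences of exponents of two preimages.\<close>

theorem d_group_internal_direct_product:
  "internal_direct_product (cyclotomic_group (m + 2)) (d_indices (m + 2)) (d_factor (m + 2)) (d_group (m + 2))"
proof -
  let ?G = "cyclotomic_group (m + 2)" and ?I = "{..<2 ^ m - 1 :: nat}"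
  let ?d = "\<lambda>l. circular_d (m + 2) (2 * int l + 1)"
  have d_carrier: "?d l \<in> carrier ?G" for l by (rule circular_d_carrier) simp
  have factor: "d_factor (m + 2) l = {?d l powi k |k. True}" for l
    unfolding d_factor_def by (rule generate_singleton[OF d_carrier])
  have factor_closed: "mult_closed (d_factor (m + 2) l)" for l
    unfolding d_factor_def using d_carrier by (intro generate_mult_closed) blast
  have factor_carrier: "d_factor (m + 2) l \<subseteq> carrier ?G" for l
    unfolding d_factor_def using d_carrier
    by (intro generate_subset_mult_closed cyclotomic_group_carrier_mult_closed) blast+
  have fin: "finprod ?G x ?I = (\<Prod>l\<in>?I. x l)" if "x \<in> (\<Pi>\<^sub>E l\<in>?I. d_factor (m + 2) l)" for x
    using that factor_carrier by (intro finprod_cyclotomic_group) (auto simp: PiE_iff subset_iff)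
  have exps: "\<exists>a. \<forall>l\<in>?I. x l = ?d l powi a l" if "x \<in> (\<Pi>\<^sub>E l\<in>?I. d_factor (m + 2) l)" for x
    using that unfolding PiE_iff factor by (intro bchoice) auto
  have prod_D: "(\<Prod>l\<in>?I. x l) \<in> d_group (m + 2)" if x: "x \<in> (\<Pi>\<^sub>E l\<in>?I. d_factor (m + 2) l)" for x
  proof -
    obtain a where "\<forall>l\<in>?I. x l = ?d l powi a l" using exps[OF x] by blast
    then have "(\<Prod>l\<in>?I. x l) = (\<Prod>l\<in>?I. ?d l powi a l)" by (intro prod.cong) simp_all
    then show ?thesis unfolding d_group_eq power_products_def by blast
  qed
  have inj: "inj_on (\<lambda>x. finprod ?G x ?I) (\<Pi>\<^sub>E l\<in>?I. d_factor (m + 2) l)"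
  proof (rule inj_onI)
    fix x y assume x: "x \<in> (\<Pi>\<^sub>E l\<in>?I. d_factor (m + 2) l)" and y: "y \<in> (\<Pi>\<^sub>E l\<in>?I. d_factor (m + 2) l)"
      and eq: "finprod ?G x ?I = finprod ?G y ?I"
    obtain a where a: "\<forall>l\<in>?I. x l = ?d l powi a l" using exps[OF x] by blast
    obtain b where b: "\<forall>l\<in>?I. y l = ?d l powi b l" using exps[OF y] by blast
    have nz: "?d l \<noteq> 0" for l using circular_d_nonzero[of "2 * int l + 1" "m + 1"] by simp
    have "(\<Prod>l\<in>?I. ?d l powi a l) = (\<Prod>l\<in>?I. ?d l powi b l)"
      using eq a b unfolding fin[OF x] fin[OF y] by simp
    moreover have "(\<Prod>l\<in>?I. ?d l powi b l) \<noteq> 0" using nz by simp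
    ultimately have "(\<Prod>l\<in>?I. ?d l powi (a l - b l)) = 1"
      using nz by (simp add: power_int_diff prod_dividef)
    then have "a l - b l = 0" if "l < 2 ^ m - 1" for l
      using circular_d_independent[OF _ that, of "\<lambda>l. a l - b l"] by simp
    then have "x l = y l" if "l \<in> ?I" for l using that a b by simp
    then show "x = y" by (rule PiE_ext[OF x y])
  qed
  show ?thesis
    unfolding internal_direct_product_def d_indices_eq
  proof (intro conjI ballI)
    show "subgroup (d_factor (m + 2) l) ?G" for l
      by (rule mult_closed_subgroup[OF factor_closed factor_carrier])
    show "subgroup (d_group (m + 2)) ?G"
      by (rule mult_closed_subgroup[OF d_group_mult_closed d_group_carrier])
    show "(\<lambda>x. finprod ?G x ?I) \<in> iso (product_group ?I (\<lambda>l. ?G\<lparr>carrier := d_factor (m + 2) l\<rparr>))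
        (?G\<lparr>carrier := d_group (m + 2)\<rparr>)"
    proof (rule isoI)
      show "(\<lambda>x. finprod ?G x ?I) \<in> hom (product_group ?I (\<lambda>l. ?G\<lparr>carrier := d_factor (m + 2) l\<rparr>))
        (?G\<lparr>carrier := d_group (m + 2)\<rparr>)"
      proof (rule homI)
        fix x assume "x \<in> carrier (product_group ?I (\<lambda>l. ?G\<lparr>carrier := d_factor (m + 2) l\<rparr>))"
        then have "x \<in> (\<Pi>\<^sub>E l\<in>?I. d_factor (m + 2) l)" by simp
        then show "finprod ?G x ?I \<in> carrier (?G\<lparr>carrier := d_group (m + 2)\<rparr>)"
          using fin prod_D by simp
        fix y assume "y \<in> carrier (product_group ?I (\<lambda>l. ?G\<lparr>carrier := d_factor (m + 2) l\<rparr>))"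
        then have y: "y \<in> (\<Pi>\<^sub>E l\<in>?I. d_factor (m + 2) l)" by simp
        have x: "x \<in> (\<Pi>\<^sub>E l\<in>?I. d_factor (m + 2) l)" by fact
        have xy: "(\<lambda>l\<in>?I. x l * y l) \<in> (\<Pi>\<^sub>E l\<in>?I. d_factor (m + 2) l)"
          using x y mult_closedD(2)[OF factor_closed] by (simp add: PiE_iff)
        have "finprod ?G (\<lambda>l\<in>?I. x l * y l) ?I = (\<Prod>l\<in>?I. x l) * (\<Prod>l\<in>?I. y l)"
          unfolding fin[OF xy] by (simp add: prod.distrib)
        then show "finprod ?G (x \<otimes>\<^bsub>product_group ?I (\<lambda>l. ?G\<lparr>carrier := d_factor (m + 2) l\<rparr>)\<^esub> y) ?I
          = finprod ?G x ?I \<otimes>\<^bsub>?G\<lparr>carrier := d_group (m + 2)\<rparr>\<^esub> finprod ?G y ?I"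
          unfolding fin[OF x] fin[OF y] by simp
      qed
      have "(\<lambda>x. finprod ?G x ?I) ` (\<Pi>\<^sub>E l\<in>?I. d_factor (m + 2) l) = d_group (m + 2)"
      proof
        show "(\<lambda>x. finprod ?G x ?I) ` (\<Pi>\<^sub>E l\<in>?I. d_factor (m + 2) l) \<subseteq> d_group (m + 2)"
          using fin prod_D by auto
        show "d_group (m + 2) \<subseteq> (\<lambda>x. finprod ?G x ?I) ` (\<Pi>\<^sub>E l\<in>?I. d_factor (m + 2) l)"
        proof
          fix y assume "y \<in> d_group (m + 2)"
          then obtain a where y: "y = (\<Prod>l\<in>?I. ?d l powi a l)"
            unfolding d_group_eq power_products_def by blast
          define x where "x = (\<lambda>l\<in>?I. ?d l powi a l)"
          have x: "x \<in> (\<Pi>\<^sub>E l\<in>?I. d_factor (m + 2) l)"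
            unfolding x_def PiE_iff factor by auto
          have "y = finprod ?G x ?I" unfolding fin[OF x] y by (simp add: x_def)
          then show "y \<in> (\<lambda>x. finprod ?G x ?I) ` (\<Pi>\<^sub>E l\<in>?I. d_factor (m + 2) l)" using x by blast
        qed
      qed
      then show "bij_betw (\<lambda>x. finprod ?G x ?I)
          (carrier (product_group ?I (\<lambda>l. ?G\<lparr>carrier := d_factor (m + 2) l\<rparr>)))
          (carrier (?G\<lparr>carrier := d_group (m + 2)\<rparr>))"
        using inj by (simp add: bij_betw_def)
    qed
  qed
qed

theorem mainTheorem3:
  fixes n :: nat
  assumes "n \<ge> 2"
  shows "internal_direct_product (cyclotomic_group n) (d_indices n) (d_factor n) (d_group n)
    \<and> internal_direct_product2 (cyclotomic_group n)
           (generate (cyclotomic_group n) {root2n n}) (d_group n) (circular_units n)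
    \<and> internal_direct_product2 (cyclotomic_group n)
           (generate (cyclotomic_group n) {-1}) (d_group n) (circular_units n \<inter> \<real>)"
proof -
  obtain m where n: "n = m + 2" using assms by (metis add.commute le_Suc_ex)
  let ?G = "cyclotomic_group (m + 2)"
  have roots: "generate ?G {root2n (m + 2)} = {root2n (m + 2) powi k |k. True}"
    by (rule generate_singleton[OF root2n_carrier])
  have roots_carrier: "{root2n (m + 2) powi k |k. True} \<subseteq> carrier ?G"
    using mult_closed_powi[OF cyclotomic_group_carrier_mult_closed root2n_carrier] by blast
  then have "-1 \<in> carrier ?G" using minus_one_root2n_powi[of m] by auto
  then have "generate ?G {-1} = {(-1) powi k |k. True}" by (rule generate_singleton)
  also have "\<dots> = {1, -1}"
  proof -
    have "(-1::complex) powi k \<in> {1, -1}" for k by (cases "even k") simp_all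
    then have "{(-1::complex) powi k |k. True} \<subseteq> {1, -1}" by blast
    moreover have "(-1::complex) powi 0 = 1" "(-1::complex) powi 1 = -1" by simp_all
    then have "{1, -1} \<subseteq> {(-1::complex) powi k |k. True}"
      by (metis (mono_tags, lifting) empty_subsetI insert_subset mem_Collect_eq)
    ultimately show ?thesis by (rule equalityI)
  qed
  finally have signs: "generate ?G {-1} = {1, -1}" .
  have signs_closed: "mult_closed {1, -1}" by (auto simp: mult_closed_def)
  have signs_carrier: "{1, -1} \<subseteq> carrier ?G"
    using \<open>-1 \<in> carrier ?G\<close> mult_closedD(1)[OF cyclotomic_group_carrier_mult_closed] by blast
  have "internal_direct_product2 ?G {root2n (m + 2) powi k |k. True} (d_group (m + 2)) (circular_units (m + 2))"
  proof (rule internal_direct_product2_cyclotomic)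
    show "{root2n (m + 2) powi k |k. True} \<inter> d_group (m + 2) \<subseteq> {1}"
      using root2n_powi_real d_group_real d_group_trivial_torsion by blast
    show "circular_units (m + 2) = {x * y |x y. x \<in> {root2n (m + 2) powi k |k. True} \<and> y \<in> d_group (m + 2)}"
      unfolding circular_units_eq unit_group_def ..
  qed (fact root2n_powi_mult_closed roots_carrier d_group_mult_closed d_group_carrier)+
  moreover have "internal_direct_product2 ?G {1, -1} (d_group (m + 2)) (circular_units (m + 2) \<inter> \<real>)"
  proof (rule internal_direct_product2_cyclotomic)
    show "{1, -1} \<inter> d_group (m + 2) \<subseteq> {1}"
      using d_group_trivial_torsion by blast
    show "circular_units (m + 2) \<inter> \<real> = {x * y |x y. x \<in> {1, -1} \<and> y \<in> d_group (m + 2)}"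
    proof (intro equalityI subsetI)
      fix x assume x: "x \<in> circular_units (m + 2) \<inter> \<real>"
      then obtain k y where y: "x = root2n (m + 2) powi k * y" "y \<in> d_group (m + 2)"
        unfolding circular_units_eq unit_group_def by blast
      have "y \<noteq> 0" "y \<in> \<real>" using y(2) d_group_carrier d_group_real by auto
      then have "root2n (m + 2) powi k \<in> \<real>"
        using x y(1) Reals_divide[of x y] by simp
      then have "root2n (m + 2) powi k \<in> {1, -1}" by (rule root2n_powi_real)
      then show "x \<in> {x * y |x y. x \<in> {1, -1} \<and> y \<in> d_group (m + 2)}" using y by blast
    next
      fix x assume "x \<in> {x * y |x y. x \<in> {1, -1} \<and> y \<in> d_group (m + 2)}"
      then obtain s y where y: "x = s * y" "s \<in> {1, -1}" "y \<in> d_group (m + 2)" by blast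
      have "y \<in> unit_group m" by (rule d_group_unit_group[OF y(3)])
      then have "x \<in> unit_group m" using y minus_unit_group by auto
      moreover have "y \<in> \<real>" using y(3) d_group_real by blast
      then have "x \<in> \<real>" using y by auto
      ultimately show "x \<in> circular_units (m + 2) \<inter> \<real>" unfolding circular_units_eq by blast
    qed
  qed (fact signs_closed signs_carrier d_group_mult_closed d_group_carrier)+
  ultimately show ?thesis
    unfolding n roots signs using d_group_internal_direct_product by blast
qed

end
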